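(* Let $(S,\Sigma)$ be a measurable space, $\mu$ a probability measure on $(S,\Sigma)$, and let $X$ be a Banach space with type $2$. For all $\phi\in L^2(\mu;X)$ the formula $$F(A):=\int_A\phi\,d\mu,\quad A\in\Sigma,$$ defines a countably additive vector measure $F:\Sigma\to X$ which has bounded $\gamma$-variation with respect to $\mu$. Moreover, $$\|F\|_{V_\gamma(\mu;X)}\le\|\phi\|_{L^2(\mu;X)}.$$ If $\dim L^2(\mu)=\infty$, this property characterises the type $2$ property of $X$.
   Context: Integrals of $X$-valued functions in $L^2(\mu;X)$ are Bochner integrals. Let $(\gamma_n)_{n\ge 1}$ be a sequence of independent standard Gaussian random variables on a probability space $(\Omega,\mathscr{F},\mathbb{P})$, with expectation $\mathbb{E}$. Bounded $\gamma$-variation: a countably additive vector measure $F:\Sigma\to X$ has bounded $\gamma$-variation with respect to $\mu$ if $\|F\|_{V_\gamma(\mu;X)}<\infty$, where $$\|F\|_{V_\gamma(\mu;X)}:=\sup\Big(\mathbb{E}\Big\|\sum_{n=1}^N\gamma_n\frac{F(A_n)}{\sqrt{\mu(A_n)}}\Big\|^2\Big)^{1/2},$$ the supremum being taken over all finite collections of disjoint sets $A_1,\dots,A_N\in\Sigma$ such that $\mu(A_n)>0$ for all $n=1,\dots,N$. Type $2$: $X$ has type $2$ if there is a constant $C$ such that $\mathbb{E}\|\sum_{n=1}^N r_nx_n\|^2\le C^2\sum_{n=1}^N\|x_n\|^2$ for all $N\ge 1$ and $x_1,\dots,x_N\in X$, where $(r_n)_{n\ge 1}$ is a sequence of independent random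 variables with $\mathbb{P}(r_n=\pm1)=\frac12$.
   Formalization: The printed bound ‖F‖ ≤ ‖φ‖ fails for general type 2 spaces (e.g. the plane with the maximum norm); it is stated as ‖F‖ ≤ C‖φ‖ for every admissible type 2 constant C of X, which gives the printed bound when C = 1 (Hilbert spaces). *)

theory Defs
  imports "HOL-Probability.Probability"
begin

text \<open>
  The Bochner integral of the library is restricted to second countable (hence separable)
  spaces. The following definitions repeat its construction from simple functions for an
  arbitrary normed space, with Borel measurability replaced by strong measurability.
  Every almost everywhere limit of simple functions agrees almost everywhere with a function
  that is strongly measurable in the sense below.
\<close>

definition strongly_measurable :: "'s measure \<Rightarrow> ('s \<Rightarrow> 'x::real_normed_vector) \<Rightarrow> bool" where
  "strongly_measurable M f \<longleftrightarrow>
     (\<exists>s. (\<forall>i::nat. simple_function M (s i)) \<and> (\<forall>x\<in>space M. (\<lambda>i. s i x) \<longlonglongrightarrow> f x))"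

definition has_strong_bochner_integral ::
    "'s measure \<Rightarrow> ('s \<Rightarrow> 'x::real_normed_vector) \<Rightarrow> 'x \<Rightarrow> bool" where
  "has_strong_bochner_integral M f I \<longleftrightarrow>
     strongly_measurable M f \<and>
     (\<exists>s. (\<forall>i::nat. Bochner_Integration.simple_bochner_integrable M (s i)) \<and>
          (\<lambda>i. \<integral>\<^sup>+x. ennreal (norm (f x - s i x)) \<partial>M) \<longlonglongrightarrow> 0 \<and>
          (\<lambda>i. Bochner_Integration.simple_bochner_integral M (s i)) \<longlonglongrightarrow> I)"

definition strong_bochner_integral ::
    "'s measure \<Rightarrow> ('s \<Rightarrow> 'x::real_normed_vector) \<Rightarrow> 'x" where
  "strong_bochner_integral M f =
     (if \<exists>I. has_strong_bochner_integral M f I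
      then THE I. has_strong_bochner_integral M f I else 0)"

definition indefinite_integral ::
    "'s measure \<Rightarrow> ('s \<Rightarrow> 'x::real_normed_vector) \<Rightarrow> 's set \<Rightarrow> 'x" where
  "indefinite_integral M \<phi> A = strong_bochner_integral M (\<lambda>s. indicator A s *\<^sub>R \<phi> s)"

text \<open>
  Elements of \<open>L\<^sup>2\<close> are represented by functions; equality in \<open>L\<^sup>2\<close> is equality almost everywhere.
\<close>

definition L2 :: "'s measure \<Rightarrow> ('s \<Rightarrow> 'x::real_normed_vector) set" where
  "L2 M = {\<phi>. strongly_measurable M \<phi> \<and> integrable M (\<lambda>s. (norm (\<phi> s))\<^sup>2)}"

definition L2_norm :: "'s measure \<Rightarrow> ('s \<Rightarrow> 'x::real_normed_vector) \<Rightarrow> real" where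
  "L2_norm M \<phi> = sqrt (LINT s|M. (norm (\<phi> s))\<^sup>2)"

definition infinite_dimensional_L2 :: "'s measure \<Rightarrow> bool" where
  "infinite_dimensional_L2 M \<longleftrightarrow>
     \<not> (\<exists>B :: ('s \<Rightarrow> real) set. finite B \<and> B \<subseteq> L2 M \<and>
          (\<forall>f\<in>L2 M. \<exists>c. AE s in M. f s = (\<Sum>b\<in>B. c b * b s)))"

definition vector_measure :: "'s measure \<Rightarrow> ('s set \<Rightarrow> 'x::real_normed_vector) \<Rightarrow> bool" where
  "vector_measure M F \<longleftrightarrow>
     (\<forall>A :: nat \<Rightarrow> 's set. range A \<subseteq> sets M \<longrightarrow> disjoint_family A \<longrightarrow>
        (\<lambda>n. F (A n)) sums F (\<Union>n. A n))"

definition gaussian_sequence :: "'w measure \<Rightarrow> (nat \<Rightarrow> 'w \<Rightarrow> real) \<Rightarrow> bool" where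
  "gaussian_sequence P g \<longleftrightarrow>
     prob_space P \<and> prob_space.indep_vars P (\<lambda>_. borel) g UNIV \<and>
     (\<forall>n. distributed P lborel (g n) (\<lambda>x. ennreal (std_normal_density x)))"

definition rademacher_sequence :: "'v measure \<Rightarrow> (nat \<Rightarrow> 'v \<Rightarrow> real) \<Rightarrow> bool" where
  "rademacher_sequence R r \<longleftrightarrow>
     prob_space R \<and> prob_space.indep_vars R (\<lambda>_. borel) r UNIV \<and>
     (\<forall>n. measure R {w\<in>space R. r n w = 1} = 1/2 \<and>
          measure R {w\<in>space R. r n w = - 1} = 1/2)"

text \<open>
  All moments of Gaussian variables are finite, so the expectation is that of an integrable
  function; the supremum may be infinite.
\<close>

definition gamma_variation ::
    "'w measure \<Rightarrow> (nat \<Rightarrow> 'w \<Rightarrow> real) \<Rightarrow> 's measure \<Rightarrow> ('s set \<Rightarrow> 'x::real_normed_vector) \<Rightarrow> ennreal"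
where
  "gamma_variation P g M F =
     (SUP (N, A) \<in> {(N :: nat, A :: nat \<Rightarrow> 's set).
          (\<forall>n<N. A n \<in> sets M \<and> 0 < measure M (A n)) \<and> disjoint_family_on A {..<N}}.
        ennreal (sqrt (LINT w|P.
          (norm (\<Sum>n<N. g n w *\<^sub>R (F (A n) /\<^sub>R sqrt (measure M (A n)))))\<^sup>2)))"

definition bounded_gamma_variation ::
    "'w measure \<Rightarrow> (nat \<Rightarrow> 'w \<Rightarrow> real) \<Rightarrow> 's measure \<Rightarrow> ('s set \<Rightarrow> 'x::real_normed_vector) \<Rightarrow> bool"
where
  "bounded_gamma_variation P g M F \<longleftrightarrow> gamma_variation P g M F < \<infinity>"

text \<open>
  An estimate of the \<open>\<gamma>\<close>-variation of an indefinite integral by the \<open>L\<^sup>2\<close>-norm of its density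
  has to carry the type 2 constant of the space. For the maximum norm on the plane, the uniform
  measure on two points and the density with values \<open>\<surd>2 (1, 1)\<close> and \<open>\<surd>2 (1, - 1)\<close>, the square
  of the \<open>L\<^sup>2\<close>-norm is \<open>2\<close>, whereas the square of the \<open>\<gamma>\<close>-variation is at least
  \<open>E (\<bar>\<gamma>\<^sub>1\<bar> + \<bar>\<gamma>\<^sub>2\<bar>)\<^sup>2 = 2 + 4/\<pi>\<close>.
\<close>

definition type2_constant ::
    "'v measure \<Rightarrow> (nat \<Rightarrow> 'v \<Rightarrow> real) \<Rightarrow> 'x::real_normed_vector itself \<Rightarrow> real \<Rightarrow> bool" where
  "type2_constant R r _ C \<longleftrightarrow>
     0 \<le> C \<and>
     (\<forall>N\<ge>1. \<forall>x :: nat \<Rightarrow> 'x.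
        (LINT w|R. (norm (\<Sum>n<N. r n w *\<^sub>R x n))\<^sup>2) \<le> C\<^sup>2 * (\<Sum>n<N. (norm (x n))\<^sup>2))"

definition type2 ::
    "'v measure \<Rightarrow> (nat \<Rightarrow> 'v \<Rightarrow> real) \<Rightarrow> 'x::real_normed_vector itself \<Rightarrow> bool" where
  "type2 R r X \<longleftrightarrow> (\<exists>C. type2_constant R r X C)"

end

theory Submission
  imports Defs
begin

text \<open>
  Multiplying independent Gaussian variables by independent signs does not change their joint law.
  Conditioning on the Gaussian variables therefore carries the type 2 inequality over to Gaussian
  sums, with the same constant, and the Cauchy-Schwarz inequality gives
  \<open>(norm (F A))\<^sup>2 / \<mu> A \<le> \<integral>\<^bsub>A\<^esub> (norm \<phi>)\<^sup>2\<close>; summing over disjoint sets bounds the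
  \<open>\<gamma>\<close>-variation. Conversely, Gaussian sums dominate Rademacher sums by Jensen's inequality, so if
  \<open>X\<close> does not have type 2, there are finite families of small square sum with large Gaussian sums. When
  \<open>L\<^sup>2\<close> is infinite-dimensional there are infinitely many disjoint sets of positive measure, and
  over these such families can be put together to a single density whose indefinite integral has
  infinite \<open>\<gamma>\<close>-variation.
\<close>

section \<open>The Bochner integral of strongly measurable functions\<close>

text \<open>\<open>X\<close> need not be separable, and then sums of Borel measurable
  \<open>X\<close>-valued functions need not be measurable. The proof therefore passes through
  strong measurability and through norms, which are real-valued; most limits and exchanges of
  integrals are carried out with nonnegative integrals, where no integrability has to be known in
  advance.

  The Gaussian and the Rademacher sequence live on unrelated probability spaces; the randomised sums
  live on the product, and Tonelli's theorem lets either factor be fixed first.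

  The hypothesis of the converse gives finiteness for each density separately and no uniform bound,
  so one single density has to defeat it. If \<open>4 ^ k\<close> is not a type 2 constant, some
  family has Rademacher second moment above \<open>16 ^ k\<close> times its square sum; rescaled to
  square sum \<open>(1 / 4) ^ k\<close> it still has second moment at least \<open>4 ^ k\<close>.
  The square sums are thus summable over \<open>k\<close> while the Gaussian sums diverge, losing
  only the factor \<open>2 / pi\<close>, the square of the mean of
  \<open>\<bar>g n\<bar>\<close>.\<close>

lemma strongly_measurable_simple:
  "simple_function M f \<Longrightarrow> strongly_measurable M f"
  unfolding strongly_measurable_def by (intro exI[of _ "\<lambda>_. f"]) simp

text \<open>Continuity of \<open>p\<close> carries pointwise approximations of \<open>f\<close> and
  \<open>g\<close> by simple functions to such an approximation of the result. This works in
  nonseparable spaces too, where it replaces Borel measurability of sums and products.\<close>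

lemma strongly_measurable_compose2:
  fixes f :: "'s \<Rightarrow> 'a::real_normed_vector" and g :: "'s \<Rightarrow> 'b::real_normed_vector"
    and p :: "'a \<Rightarrow> 'b \<Rightarrow> 'c::real_normed_vector"
  assumes "strongly_measurable M f" "strongly_measurable M g"
    and p: "continuous_on UNIV (\<lambda>z. p (fst z) (snd z))"
  shows "strongly_measurable M (\<lambda>x. p (f x) (g x))"
proof -
  obtain s t where s: "\<And>i::nat. simple_function M (s i)"
      "\<And>x. x \<in> space M \<Longrightarrow> (\<lambda>i. s i x) \<longlonglongrightarrow> f x"
    and t: "\<And>i::nat. simple_function M (t i)"
      "\<And>x. x \<in> space M \<Longrightarrow> (\<lambda>i. t i x) \<longlonglongrightarrow> g x"
    using assms(1,2) unfolding strongly_measurable_def by blast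
  have "(\<lambda>i. p (s i x) (t i x)) \<longlonglongrightarrow> p (f x) (g x)" if "x \<in> space M" for x
    using continuous_on_tendsto_compose[OF p tendsto_Pair[OF s(2) t(2)], OF that that] by simp
  moreover have "simple_function M (\<lambda>x. p (s i x) (t i x))" for i
    using s(1) t(1) by (rule simple_function_compose2)
  ultimately show ?thesis
    unfolding strongly_measurable_def by (intro exI[of _ "\<lambda>i x. p (s i x) (t i x)"]) simp
qed

lemma strongly_measurable_compose:
  fixes f :: "'s \<Rightarrow> 'a::real_normed_vector" and p :: "'a \<Rightarrow> 'c::real_normed_vector"
  assumes "strongly_measurable M f" "continuous_on UNIV p"
  shows "strongly_measurable M (\<lambda>x. p (f x))"
proof (rule strongly_measurable_compose2[OF assms(1,1), where p = "\<lambda>x y. p x"])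
  show "continuous_on UNIV (\<lambda>z::'a \<times> 'a. p (fst z))"
    by (rule continuous_on_compose2[OF assms(2) continuous_on_fst[OF continuous_on_id]]) simp
qed

lemma strongly_measurable_add:
  "strongly_measurable M f \<Longrightarrow> strongly_measurable M g \<Longrightarrow>
    strongly_measurable M (\<lambda>x. f x + g x)"
  by (rule strongly_measurable_compose2[where p = "(+)"])
     (assumption | rule continuous_on_add continuous_on_fst continuous_on_snd continuous_on_id)+

lemma strongly_measurable_indicator:
  fixes f :: "'s \<Rightarrow> 'a::real_normed_vector"
  assumes "A \<in> sets M" "strongly_measurable M f"
  shows "strongly_measurable M (\<lambda>x. indicator A x *\<^sub>R f x)"
proof (rule strongly_measurable_compose2[where p = "(*\<^sub>R)"])
  show "strongly_measurable M (indicator A :: 's \<Rightarrow> real)"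
    using assms(1) by (intro strongly_measurable_simple simple_function_indicator)
  show "continuous_on UNIV (\<lambda>z :: real \<times> 'a. fst z *\<^sub>R snd z)"
    by (intro continuous_on_scaleR continuous_on_fst continuous_on_snd continuous_on_id)
qed fact

text \<open>The way back to ordinary measurability for scalar functions: it is applied to norms of
  strongly measurable functions and to real elements of \<open>L2\<close>.\<close>

lemma borel_measurable_strongly_measurable:
  fixes f :: "'s \<Rightarrow> 'a::{real_normed_vector, second_countable_topology}"
  assumes "strongly_measurable M f"
  shows "f \<in> borel_measurable M"
proof -
  obtain s where s: "\<And>i::nat. simple_function M (s i)"
      "\<And>x. x \<in> space M \<Longrightarrow> (\<lambda>i. s i x) \<longlonglongrightarrow> f x"
    using assms unfolding strongly_measurable_def by blast
  show ?thesis
    by (rule borel_measurable_LIMSEQ_metric[where f = s])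
       (use s in \<open>auto intro: borel_measurable_simple_function\<close>)
qed

lemma strongly_measurable_borel:
  fixes f :: "'s \<Rightarrow> 'a::{real_normed_vector, second_countable_topology}"
  assumes "f \<in> borel_measurable M"
  shows "strongly_measurable M f"
  using borel_measurable_implies_sequence_metric[OF assms, of 0]
  unfolding strongly_measurable_def by blast

lemma borel_measurable_norm_strongly_measurable:
  "strongly_measurable M f \<Longrightarrow> (\<lambda>x. norm (f x)) \<in> borel_measurable M"
  by (rule borel_measurable_strongly_measurable[OF strongly_measurable_compose[OF _ continuous_on_norm_id]])

lemma borel_measurable_norm_diff_simple:
  fixes f :: "'s \<Rightarrow> 'a::real_normed_vector"
  assumes "strongly_measurable M f" "simple_function M s"
  shows "(\<lambda>x. norm (f x - s x)) \<in> borel_measurable M"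
proof -
  have "continuous_on UNIV (\<lambda>z :: 'a \<times> 'a. fst z - snd z)"
    by (intro continuous_on_diff continuous_on_fst continuous_on_snd continuous_on_id)
  from strongly_measurable_compose2[OF assms(1) strongly_measurable_simple[OF assms(2)] this]
  show ?thesis
    by (rule borel_measurable_norm_strongly_measurable)
qed

section \<open>Norm bound, linearity and uniqueness of the Bochner integral\<close>

lemma simple_bochner_integrable_simple_function:
  "Bochner_Integration.simple_bochner_integrable M s \<Longrightarrow> simple_function M s"
  by (erule simple_bochner_integrable.cases)

lemma simple_bochner_integral_norm_le_nn_integral:
  assumes s: "Bochner_Integration.simple_bochner_integrable M s"
  shows "ennreal (norm (Bochner_Integration.simple_bochner_integral M s)) \<le> (\<integral>\<^sup>+x. norm (s x) \<partial>M)"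
proof -
  have "ennreal (norm (Bochner_Integration.simple_bochner_integral M s)) \<le> Bochner_Integration.simple_bochner_integral M (\<lambda>x. norm (s x))"
    using simple_bochner_integral_norm_bound[OF s] by (rule ennreal_leI)
  also have "\<dots> = (\<integral>\<^sup>+x. norm (s x) \<partial>M)"
    by (rule simple_bochner_integral_eq_nn_integral,
        rule simple_bochner_integrable_compose2[OF _ s s, of "\<lambda>x y. norm x"]) simp_all
  finally show ?thesis .
qed

text \<open>Compare with an approximating simple function and let the error tend to
  \<open>0\<close>; the right side may be infinite. This one estimate yields uniqueness, countable
  additivity and Jensen's inequality below.\<close>

lemma has_strong_bochner_integral_norm_bound:
  assumes "has_strong_bochner_integral M f I"
  shows "ennreal (norm I) \<le> (\<integral>\<^sup>+x. norm (f x) \<partial>M)"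
proof -
  obtain s where f: "strongly_measurable M f"
    and s: "\<And>i::nat. Bochner_Integration.simple_bochner_integrable M (s i)"
    and lim: "(\<lambda>i. \<integral>\<^sup>+x. ennreal (norm (f x - s i x)) \<partial>M) \<longlonglongrightarrow> 0"
    and I: "(\<lambda>i. Bochner_Integration.simple_bochner_integral M (s i)) \<longlonglongrightarrow> I"
    using assms unfolding has_strong_bochner_integral_def by blast
  note [measurable] = borel_measurable_norm_strongly_measurable[OF f]
    borel_measurable_norm_diff_simple[OF f simple_bochner_integrable_simple_function[OF s]]
  have le: "ennreal (norm (Bochner_Integration.simple_bochner_integral M (s i))) \<le>
      (\<integral>\<^sup>+x. norm (f x) \<partial>M) + (\<integral>\<^sup>+x. norm (f x - s i x) \<partial>M)" for i
  proof -
    have "ennreal (norm (Bochner_Integration.simple_bochner_integral M (s i))) \<le> (\<integral>\<^sup>+x. norm (s i x) \<partial>M)"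
      using s by (rule simple_bochner_integral_norm_le_nn_integral)
    also have "\<dots> \<le> (\<integral>\<^sup>+x. ennreal (norm (f x)) + ennreal (norm (f x - s i x)) \<partial>M)"
      by (intro nn_integral_mono)
         (simp flip: ennreal_plus, metis add.commute norm_minus_commute norm_triangle_sub)
    also have "\<dots> = (\<integral>\<^sup>+x. norm (f x) \<partial>M) + (\<integral>\<^sup>+x. norm (f x - s i x) \<partial>M)"
      by (rule nn_integral_add) auto
    finally show ?thesis .
  qed
  have "(\<lambda>i. ennreal (norm (Bochner_Integration.simple_bochner_integral M (s i)))) \<longlonglongrightarrow> ennreal (norm I)"
    by (intro tendsto_ennrealI tendsto_norm I)
  moreover have "(\<lambda>i. (\<integral>\<^sup>+x. norm (f x) \<partial>M) + (\<integral>\<^sup>+x. norm (f x - s i x) \<partial>M))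
      \<longlonglongrightarrow> (\<integral>\<^sup>+x. norm (f x) \<partial>M) + 0"
    by (intro tendsto_add tendsto_const lim)
  ultimately show ?thesis
    using le by (auto intro: LIMSEQ_le)
qed

text \<open>\<open>T\<close> maps approximating simple functions to such functions and enlarges the
  error at most by the factor \<open>K\<close>. Applied to \<open>\<lambda>t. t *\<^sub>R y\<close>
  it turns scalar integrals into vector integrals.\<close>

lemma has_strong_bochner_integral_linear:
  assumes T: "bounded_linear T" and "has_strong_bochner_integral M f I"
  shows "has_strong_bochner_integral M (\<lambda>x. T (f x)) (T I)"
proof -
  interpret T: bounded_linear T by fact
  obtain s where f: "strongly_measurable M f"
    and s: "\<And>i::nat. Bochner_Integration.simple_bochner_integrable M (s i)"
    and lim: "(\<lambda>i. \<integral>\<^sup>+x. ennreal (norm (f x - s i x)) \<partial>M) \<longlonglongrightarrow> 0"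
    and I: "(\<lambda>i. Bochner_Integration.simple_bochner_integral M (s i)) \<longlonglongrightarrow> I"
    using assms(2) unfolding has_strong_bochner_integral_def by blast
  note [measurable] = borel_measurable_norm_diff_simple[OF f simple_bochner_integrable_simple_function[OF s]]
  obtain K where K: "0 \<le> K" "\<And>x. norm (T x) \<le> norm x * K"
    using T.nonneg_bounded by blast
  have "strongly_measurable M (\<lambda>x. T (f x))"
    using f T.continuous_on[OF continuous_on_id] by (rule strongly_measurable_compose)
  moreover have "Bochner_Integration.simple_bochner_integrable M (\<lambda>x. T (s i x))" for i
    by (rule simple_bochner_integrable_compose2[OF _ s s, of "\<lambda>x y. T x"]) (simp add: T.zero)
  moreover have "(\<lambda>i. \<integral>\<^sup>+x. ennreal (norm (T (f x) - T (s i x))) \<partial>M) \<longlonglongrightarrow> 0"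
  proof (rule tendsto_sandwich[OF _ _ tendsto_const])
    have "(\<integral>\<^sup>+x. ennreal (norm (T (f x) - T (s i x))) \<partial>M)
        \<le> ennreal K * (\<integral>\<^sup>+x. norm (f x - s i x) \<partial>M)" for i
    proof -
      have "(\<integral>\<^sup>+x. ennreal (norm (T (f x) - T (s i x))) \<partial>M)
          \<le> (\<integral>\<^sup>+x. ennreal K * ennreal (norm (f x - s i x)) \<partial>M)"
        using K by (intro nn_integral_mono)
          (auto simp: mult.commute simp flip: T.diff ennreal_mult intro!: ennreal_leI)
      then show ?thesis
        by (simp add: nn_integral_cmult)
    qed
    then show "\<forall>\<^sub>F i in sequentially. (\<integral>\<^sup>+x. ennreal (norm (T (f x) - T (s i x))) \<partial>M)
        \<le> ennreal K * (\<integral>\<^sup>+x. norm (f x - s i x) \<partial>M)"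
      by simp
    have "(\<lambda>i. ennreal K * (\<integral>\<^sup>+x. norm (f x - s i x) \<partial>M)) \<longlonglongrightarrow> ennreal K * 0"
      by (rule ennreal_tendsto_cmult[OF _ lim]) simp
    then show "(\<lambda>i. ennreal K * (\<integral>\<^sup>+x. norm (f x - s i x) \<partial>M)) \<longlonglongrightarrow> 0"
      by simp
  qed simp
  moreover have "(\<lambda>i. Bochner_Integration.simple_bochner_integral M (\<lambda>x. T (s i x))) \<longlonglongrightarrow> T I"
    by (subst simple_bochner_integral_linear[OF T.linear_axioms s]) (intro T.tendsto I)
  ultimately show ?thesis
    unfolding has_strong_bochner_integral_def
    by (intro conjI exI[of _ "\<lambda>i x. T (s i x)"]) auto
qed

lemma has_strong_bochner_integral_add:
  assumes "has_strong_bochner_integral M f I" "has_strong_bochner_integral M g J"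
  shows "has_strong_bochner_integral M (\<lambda>x. f x + g x) (I + J)"
proof -
  obtain s t where f: "strongly_measurable M f"
    and s: "\<And>i::nat. Bochner_Integration.simple_bochner_integrable M (s i)"
    and lims: "(\<lambda>i. \<integral>\<^sup>+x. ennreal (norm (f x - s i x)) \<partial>M) \<longlonglongrightarrow> 0"
    and I: "(\<lambda>i. Bochner_Integration.simple_bochner_integral M (s i)) \<longlonglongrightarrow> I"
    and g: "strongly_measurable M g"
    and t: "\<And>i::nat. Bochner_Integration.simple_bochner_integrable M (t i)"
    and limt: "(\<lambda>i. \<integral>\<^sup>+x. ennreal (norm (g x - t i x)) \<partial>M) \<longlonglongrightarrow> 0"
    and J: "(\<lambda>i. Bochner_Integration.simple_bochner_integral M (t i)) \<longlonglongrightarrow> J"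
    using assms unfolding has_strong_bochner_integral_def by blast
  note [measurable] =
    borel_measurable_norm_diff_simple[OF f simple_bochner_integrable_simple_function[OF s]]
    borel_measurable_norm_diff_simple[OF g simple_bochner_integrable_simple_function[OF t]]
  have "(\<lambda>i. \<integral>\<^sup>+x. ennreal (norm ((f x + g x) - (s i x + t i x))) \<partial>M) \<longlonglongrightarrow> 0"
  proof (rule tendsto_sandwich[OF _ _ tendsto_const])
    have "(\<integral>\<^sup>+x. ennreal (norm ((f x + g x) - (s i x + t i x))) \<partial>M)
        \<le> (\<integral>\<^sup>+x. norm (f x - s i x) \<partial>M) + (\<integral>\<^sup>+x. norm (g x - t i x) \<partial>M)" for i
    proof -
      have "(\<integral>\<^sup>+x. ennreal (norm ((f x + g x) - (s i x + t i x))) \<partial>M)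
          \<le> (\<integral>\<^sup>+x. ennreal (norm (f x - s i x)) + ennreal (norm (g x - t i x)) \<partial>M)"
        by (intro nn_integral_mono)
           (simp add: norm_diff_triangle_ineq flip: ennreal_plus)
      then show ?thesis
        by (simp add: nn_integral_add)
    qed
    then show "\<forall>\<^sub>F i in sequentially.
        (\<integral>\<^sup>+x. ennreal (norm ((f x + g x) - (s i x + t i x))) \<partial>M)
        \<le> (\<integral>\<^sup>+x. norm (f x - s i x) \<partial>M) + (\<integral>\<^sup>+x. norm (g x - t i x) \<partial>M)"
      by simp
    show "(\<lambda>i. (\<integral>\<^sup>+x. norm (f x - s i x) \<partial>M) + (\<integral>\<^sup>+x. norm (g x - t i x) \<partial>M)) \<longlonglongrightarrow> 0"
      using tendsto_add[OF lims limt] by simp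
  qed simp
  moreover have "(\<lambda>i. Bochner_Integration.simple_bochner_integral M (\<lambda>x. s i x + t i x)) \<longlonglongrightarrow> I + J"
    by (subst simple_bochner_integral_add[OF s t]) (intro tendsto_add I J)
  ultimately show ?thesis
    unfolding has_strong_bochner_integral_def
    using strongly_measurable_add[OF f g]
      simple_bochner_integrable_compose2[OF _ s t, where p = "(+)"]
    by (intro conjI exI[of _ "\<lambda>i x. s i x + t i x"]) simp_all
qed

lemma has_strong_bochner_integral_diff:
  assumes "has_strong_bochner_integral M f I" "has_strong_bochner_integral M g J"
  shows "has_strong_bochner_integral M (\<lambda>x. f x - g x) (I - J)"
proof -
  have "has_strong_bochner_integral M (\<lambda>x. - g x) (- J)"
    by (rule has_strong_bochner_integral_linear[OF bounded_linear_minus[OF bounded_linear_ident] assms(2)])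
  from has_strong_bochner_integral_add[OF assms(1) this] show ?thesis
    by simp
qed

lemma has_strong_bochner_integral_unique:
  assumes "has_strong_bochner_integral M f I" "has_strong_bochner_integral M f J"
  shows "I = J"
  using has_strong_bochner_integral_norm_bound[OF has_strong_bochner_integral_diff[OF assms]]
  by simp

lemma strong_bochner_integral_eqI:
  assumes "has_strong_bochner_integral M f I"
  shows "strong_bochner_integral M f = I"
proof -
  have "(THE J. has_strong_bochner_integral M f J) = I"
    using assms by (rule the_equality) (rule has_strong_bochner_integral_unique[OF _ assms])
  then show ?thesis
    using assms unfolding strong_bochner_integral_def by metis
qed

lemma has_strong_bochner_integral_indicator:
  assumes "A \<in> sets M" "emeasure M A \<noteq> \<infinity>"
  shows "has_strong_bochner_integral M (\<lambda>x. indicator A x *\<^sub>R y) (measure M A *\<^sub>R y)"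
proof -
  have A: "Bochner_Integration.simple_bochner_integrable M (indicator A :: _ \<Rightarrow> real)"
  proof
    show "simple_function M (indicator A :: _ \<Rightarrow> real)"
      using assms by simp
    have "{x \<in> space M. indicator A x \<noteq> (0::real)} = A"
      using sets.sets_into_space[OF assms(1)] by (auto simp: indicator_def)
    then show "emeasure M {x \<in> space M. indicator A x \<noteq> (0::real)} \<noteq> \<infinity>"
      using assms by simp
  qed
  have "ennreal (Bochner_Integration.simple_bochner_integral M (indicator A :: _ \<Rightarrow> real)) = (\<integral>\<^sup>+x. ennreal (indicator A x) \<partial>M)"
    using A by (rule simple_bochner_integral_eq_nn_integral) simp
  also have "\<dots> = ennreal (measure M A)"
    using assms by (simp add: ennreal_indicator emeasure_eq_ennreal_measure)
  finally have "Bochner_Integration.simple_bochner_integral M (indicator A :: _ \<Rightarrow> real) = measure M A"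
    by (simp add: simple_bochner_integral_nonneg)
  with A have "has_strong_bochner_integral M (indicator A) (measure M A)"
    unfolding has_strong_bochner_integral_def
    by (intro conjI exI[of _ "\<lambda>_. indicator A"]
          strongly_measurable_simple simple_bochner_integrable_simple_function) auto
  then show ?thesis
    by (rule has_strong_bochner_integral_linear[OF bounded_linear_scaleR_left])
qed

lemma has_strong_bochner_integral_0: "has_strong_bochner_integral M (\<lambda>x. 0) 0"
  using has_strong_bochner_integral_indicator[of "{}" M 0] by simp

lemma has_strong_bochner_integral_sum:
  assumes "\<And>i. i \<in> A \<Longrightarrow> has_strong_bochner_integral M (f i) (I i)"
  shows "has_strong_bochner_integral M (\<lambda>x. \<Sum>i\<in>A. f i x) (\<Sum>i\<in>A. I i)"
  using assms
  by (induction A rule: infinite_finite_induct)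
     (auto intro: has_strong_bochner_integral_add has_strong_bochner_integral_0)

text \<open>The two notions use the same approximating sequences, so only strong measurability has
  to be supplied. The use is scalar: the mean of \<open>\<bar>g n\<bar>\<close> becomes a vector
  integral by linearity.\<close>

lemma has_strong_bochner_integral_integral:
  fixes f :: "'s \<Rightarrow> 'a::{banach, second_countable_topology}"
  assumes "integrable M f"
  shows "has_strong_bochner_integral M f (integral\<^sup>L M f)"
proof -
  have "strongly_measurable M f"
    using assms by (intro strongly_measurable_borel) simp
  with has_bochner_integral_integrable[OF assms] show ?thesis
    by (cases rule: has_bochner_integral.cases) (auto simp: has_strong_bochner_integral_def)
qed

text \<open>
  Truncating the approximating simple functions at \<open>2 * norm (f x)\<close> makes dominated convergence
  applicable.
\<close>

lemma has_strong_bochner_integral_exists: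
  fixes f :: "'s \<Rightarrow> 'x::banach"
  assumes f: "strongly_measurable M f" and fin: "(\<integral>\<^sup>+x. norm (f x) \<partial>M) < \<infinity>"
  shows "\<exists>I. has_strong_bochner_integral M f I"
proof -
  obtain s where s: "\<And>i::nat. simple_function M (s i)"
      "\<And>x. x \<in> space M \<Longrightarrow> (\<lambda>i. s i x) \<longlonglongrightarrow> f x"
    using f unfolding strongly_measurable_def by blast
  note nf[measurable] = borel_measurable_norm_strongly_measurable[OF f]
  have [measurable]: "(\<lambda>x. norm (s i x)) \<in> borel_measurable M" for i
    using borel_measurable_norm_strongly_measurable[OF strongly_measurable_simple[OF s(1)]] .
  define t where "t = (\<lambda>i x. indicator {x\<in>space M. norm (s i x) \<le> 2 * norm (f x)} x *\<^sub>R s i x)"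
  have t: "simple_function M (t i)" for i
    unfolding t_def using s(1)
    by (intro simple_function_compose2[where h = "(*\<^sub>R)"] simple_function_indicator) measurable
  have t_le: "norm (t i x) \<le> 2 * norm (f x)" for i x
    by (auto simp: t_def indicator_def)
  have t_lim: "(\<lambda>i. t i x) \<longlonglongrightarrow> f x" if x: "x \<in> space M" for x
  proof (cases "f x = 0")
    case True
    then have "t i x = 0" for i
      using t_le[of i x] by simp
    with True show ?thesis by simp
  next
    case False
    \<comment> \<open>Any factor above \<open>1\<close> in the truncation would do: near a nonzero
      limit the cut is eventually inactive, while at zeros of \<open>f\<close> the truncated value
      is \<open>0\<close> outright.\<close>
    have "\<forall>\<^sub>F i in sequentially. norm (s i x) < 2 * norm (f x)"
      using tendsto_norm[OF s(2)[OF x]] by (rule order_tendstoD) (use False in simp)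
    then have "\<forall>\<^sub>F i in sequentially. t i x = s i x"
      by eventually_elim (use x in \<open>simp add: t_def\<close>)
    then show ?thesis
      using s(2)[OF x] by (simp add: tendsto_cong)
  qed
  note [measurable] = borel_measurable_norm_diff_simple[OF f t]
  have "(\<integral>\<^sup>+x. ennreal (norm (t i x)) \<partial>M) < \<infinity>" for i
  proof -
    have "(\<integral>\<^sup>+x. ennreal (norm (t i x)) \<partial>M) \<le> (\<integral>\<^sup>+x. 2 * ennreal (norm (f x)) \<partial>M)"
      using t_le by (intro nn_integral_mono)
        (simp flip: ennreal_numeral ennreal_mult add: ennreal_leI)
    also have "\<dots> < \<infinity>"
      using fin by (simp add: nn_integral_cmult ennreal_mult_less_top)
    finally show ?thesis .
  qed
  then have ti: "Bochner_Integration.simple_bochner_integrable M (t i)" for i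
    using t by (intro simple_bochner_integrableI_bounded) auto
  have lim: "(\<lambda>i. \<integral>\<^sup>+x. ennreal (norm (f x - t i x)) \<partial>M) \<longlonglongrightarrow> 0"
  proof -
    have "(\<lambda>i. \<integral>\<^sup>+x. ennreal (norm (f x - t i x)) \<partial>M) \<longlonglongrightarrow> (\<integral>\<^sup>+x. ennreal 0 \<partial>M)"
    \<comment> \<open>The factor \<open>3\<close> is \<open>1\<close> for \<open>f\<close> plus
      \<open>2\<close> for the truncated function.\<close>
    proof (rule nn_integral_dominated_convergence[where w = "\<lambda>x. 3 * ennreal (norm (f x))"])
      show "AE x in M. ennreal (norm (f x - t i x)) \<le> 3 * ennreal (norm (f x))" for i
      proof (rule AE_I2)
        fix x
        have "norm (f x - t i x) \<le> 3 * norm (f x)"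
          using norm_triangle_ineq4[of "f x" "t i x"] t_le[of i x] by simp
        then show "ennreal (norm (f x - t i x)) \<le> 3 * ennreal (norm (f x))"
          by (simp flip: ennreal_numeral ennreal_mult add: ennreal_leI)
      qed
      show "(\<integral>\<^sup>+x. 3 * ennreal (norm (f x)) \<partial>M) < \<infinity>"
        using fin by (simp add: nn_integral_cmult ennreal_mult_less_top)
      show "AE x in M. (\<lambda>i. ennreal (norm (f x - t i x))) \<longlonglongrightarrow> ennreal 0"
      proof (rule AE_I2)
        fix x assume "x \<in> space M"
        then have "(\<lambda>i. norm (f x - t i x)) \<longlonglongrightarrow> norm (f x - f x)"
          by (intro tendsto_intros t_lim)
        then show "(\<lambda>i. ennreal (norm (f x - t i x))) \<longlonglongrightarrow> ennreal 0"
          by (intro tendsto_ennrealI) simp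
      qed
    qed auto
    then show ?thesis by simp
  qed
  have diff: "ennreal (norm (Bochner_Integration.simple_bochner_integral M (t i) - Bochner_Integration.simple_bochner_integral M (t j))) \<le>
      (\<integral>\<^sup>+x. norm (f x - t i x) \<partial>M) + (\<integral>\<^sup>+x. norm (f x - t j x) \<partial>M)" for i j
  proof -
    have "ennreal (norm (Bochner_Integration.simple_bochner_integral M (t i) - Bochner_Integration.simple_bochner_integral M (t j)))
        = ennreal (norm (Bochner_Integration.simple_bochner_integral M (\<lambda>x. t i x - t j x)))"
      by (simp add: simple_bochner_integral_diff ti)
    also have "\<dots> \<le> (\<integral>\<^sup>+x. norm (t i x - t j x) \<partial>M)"
      by (rule simple_bochner_integral_norm_le_nn_integral)
         (rule simple_bochner_integrable_compose2[OF _ ti ti], simp)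
    also have "\<dots> \<le> (\<integral>\<^sup>+x. ennreal (norm (f x - t i x)) + ennreal (norm (f x - t j x)) \<partial>M)"
      by (intro nn_integral_mono)
         (simp flip: ennreal_plus, metis norm_minus_commute norm_diff_triangle_le order_refl)
    also have "\<dots> = (\<integral>\<^sup>+x. norm (f x - t i x) \<partial>M) + (\<integral>\<^sup>+x. norm (f x - t j x) \<partial>M)"
      by (rule nn_integral_add) auto
    finally show ?thesis .
  qed
  \<comment> \<open>Two simple integrals differ by at most the sum of their errors, which tend to
    \<open>0\<close>; completeness of the space then supplies the integral.\<close>
  have "Cauchy (\<lambda>i. Bochner_Integration.simple_bochner_integral M (t i))"
  proof (rule metric_CauchyI)
    fix e :: real assume "0 < e"
    then have "\<forall>\<^sub>F i in sequentially. (\<integral>\<^sup>+x. norm (f x - t i x) \<partial>M) < ennreal (e / 2)"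
      by (intro order_tendstoD(2)[OF lim]) simp
    then obtain K where K: "\<And>i. i \<ge> K \<Longrightarrow> (\<integral>\<^sup>+x. norm (f x - t i x) \<partial>M) < ennreal (e / 2)"
      unfolding eventually_sequentially by blast
    have "dist (Bochner_Integration.simple_bochner_integral M (t i)) (Bochner_Integration.simple_bochner_integral M (t j)) < e"
      if "i \<ge> K" "j \<ge> K" for i j
    proof -
      have "ennreal (norm (Bochner_Integration.simple_bochner_integral M (t i) - Bochner_Integration.simple_bochner_integral M (t j)))
          < ennreal (e / 2) + ennreal (e / 2)"
        by (rule le_less_trans[OF diff add_strict_mono[OF K[OF that(1)] K[OF that(2)]]])
      also have "\<dots> = ennreal e"
        using \<open>0 < e\<close> by (simp flip: ennreal_plus)
      finally show ?thesis
        using \<open>0 < e\<close> by (simp add: dist_norm ennreal_less_iff)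
    qed
    then show "\<exists>K. \<forall>i\<ge>K. \<forall>j\<ge>K. dist (Bochner_Integration.simple_bochner_integral M (t i)) (Bochner_Integration.simple_bochner_integral M (t j)) < e"
      by blast
  qed
  then obtain I where "(\<lambda>i. Bochner_Integration.simple_bochner_integral M (t i)) \<longlonglongrightarrow> I"
    using Cauchy_convergent convergent_def by blast
  with f ti lim show ?thesis
    unfolding has_strong_bochner_integral_def by blast
qed

section \<open>Indefinite integrals of square integrable functions\<close>

text \<open>The difference of the two sides is the integral over \<open>A\<close> of the square of
  \<open>h x - t\<close>, with \<open>t\<close> the mean of \<open>h\<close> on \<open>A\<close>: a
  variance is nonnegative.\<close>

lemma square_integral_indicator_le:
  fixes h :: "'s \<Rightarrow> real"
  assumes "finite_measure M" "integrable M h" "integrable M (\<lambda>x. (h x)\<^sup>2)"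
    and A: "A \<in> sets M" "0 < measure M A"
  shows "(LINT x|M. indicator A x * h x)\<^sup>2 / measure M A \<le> (LINT x|M. indicator A x * (h x)\<^sup>2)"
proof -
  interpret finite_measure M by fact
  define t where "t = (LINT x|M. indicator A x * h x) / measure M A"
  have i: "integrable M (\<lambda>x. indicator A x * h x)" "integrable M (\<lambda>x. indicator A x * (h x)\<^sup>2)"
    "integrable M (indicator A :: 's \<Rightarrow> real)"
    using integrable_mult_indicator[OF A(1) assms(2)] integrable_mult_indicator[OF A(1) assms(3)]
      integrable_real_indicator[OF A(1)]
    by (simp_all add: emeasure_eq_measure)
  have "0 \<le> (LINT x|M. indicator A x * (h x - t)\<^sup>2)"
    by (intro integral_nonneg_AE AE_I2) simp
  also have "\<dots> = (LINT x|M. indicator A x * (h x)\<^sup>2 - 2 * t * (indicator A x * h x) + t\<^sup>2 * indicator A x)"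
    by (intro arg_cong[where f = "integral\<^sup>L M"] ext) (simp add: power2_eq_square algebra_simps)
  also have "\<dots> = (LINT x|M. indicator A x * (h x)\<^sup>2) - 2 * t * (LINT x|M. indicator A x * h x)
      + t\<^sup>2 * measure M A"
    using i A by simp
  also have "\<dots> = (LINT x|M. indicator A x * (h x)\<^sup>2) - (LINT x|M. indicator A x * h x)\<^sup>2 / measure M A"
    using A unfolding t_def by (simp add: power2_eq_square field_simps)
  finally show ?thesis by simp
qed

lemma L2_imp_integrable_norm:
  assumes "finite_measure M" "\<phi> \<in> L2 M"
  shows "integrable M (\<lambda>s. norm (\<phi> s))"
proof -
  interpret finite_measure M by fact
  show ?thesis
    using assms(2) unfolding L2_def
    by (auto intro: square_integrable_imp_integrable[OF borel_measurable_norm_strongly_measurable])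
qed

text \<open>On a finite measure space square integrability makes \<open>norm (\<phi> s)\<close>
  integrable, so the default branch of \<open>strong_bochner_integral\<close> is never reached for
  measurable \<open>A\<close>.\<close>

lemma has_strong_bochner_integral_indefinite_integral:
  fixes \<phi> :: "'s \<Rightarrow> 'x::banach"
  assumes M: "finite_measure M" and \<phi>: "\<phi> \<in> L2 M" and A: "A \<in> sets M"
  shows "has_strong_bochner_integral M (\<lambda>s. indicator A s *\<^sub>R \<phi> s) (indefinite_integral M \<phi> A)"
proof -
  have "(\<integral>\<^sup>+s. norm (indicator A s *\<^sub>R \<phi> s) \<partial>M) \<le> (\<integral>\<^sup>+s. norm (\<phi> s) \<partial>M)"
    by (intro nn_integral_mono) (auto simp: indicator_def)
  also have "\<dots> < \<infinity>"
    using L2_imp_integrable_norm[OF M \<phi>] by (simp add: integrable_iff_bounded)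
  finally obtain I where "has_strong_bochner_integral M (\<lambda>s. indicator A s *\<^sub>R \<phi> s) I"
    using has_strong_bochner_integral_exists strongly_measurable_indicator[OF A] \<phi>
    unfolding L2_def by blast
  with strong_bochner_integral_eqI[OF this] show ?thesis
    unfolding indefinite_integral_def by simp
qed

lemma norm_indefinite_integral_square_le:
  fixes \<phi> :: "'s \<Rightarrow> 'x::banach"
  assumes M: "finite_measure M" and \<phi>: "\<phi> \<in> L2 M" and A: "A \<in> sets M" "0 < measure M A"
  shows "(norm (indefinite_integral M \<phi> A))\<^sup>2 / measure M A
    \<le> (LINT s|M. indicator A s * (norm (\<phi> s))\<^sup>2)"
proof -
  have i: "integrable M (\<lambda>s. norm (\<phi> s))" "integrable M (\<lambda>s. (norm (\<phi> s))\<^sup>2)"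
    using L2_imp_integrable_norm[OF M \<phi>] \<phi> by (auto simp: L2_def)
  have iA: "integrable M (\<lambda>s. indicator A s * norm (\<phi> s))"
    using integrable_mult_indicator[OF A(1) i(1)] by simp
  have "ennreal (norm (indefinite_integral M \<phi> A)) \<le> (\<integral>\<^sup>+s. ennreal (indicator A s * norm (\<phi> s)) \<partial>M)"
    using has_strong_bochner_integral_norm_bound[OF has_strong_bochner_integral_indefinite_integral[OF M \<phi> A(1)]]
    by simp
  also have "\<dots> = ennreal (LINT s|M. indicator A s * norm (\<phi> s))"
    by (rule nn_integral_eq_integral[OF iA]) simp
  finally have "norm (indefinite_integral M \<phi> A) \<le> (LINT s|M. indicator A s * norm (\<phi> s))"
    by (subst (asm) ennreal_le_iff) (auto intro!: integral_nonneg_AE)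
  then have "(norm (indefinite_integral M \<phi> A))\<^sup>2 / measure M A
      \<le> (LINT s|M. indicator A s * norm (\<phi> s))\<^sup>2 / measure M A"
    by (intro divide_right_mono power_mono) auto
  also have "\<dots> \<le> (LINT s|M. indicator A s * (norm (\<phi> s))\<^sup>2)"
    by (rule square_integral_indicator_le[OF M i A])
  finally show ?thesis .
qed

text \<open>The remainder after \<open>N\<close> terms is the integral over the part of the union
  not yet covered. Its norm is at most a scalar integral over sets that decrease to the empty set,
  so scalar dominated convergence suffices.\<close>

lemma vector_measure_indefinite_integral:
  fixes \<phi> :: "'s \<Rightarrow> 'x::banach"
  assumes M: "finite_measure M" and \<phi>: "\<phi> \<in> L2 M"
  shows "vector_measure M (indefinite_integral M \<phi>)"
  unfolding vector_measure_def
proof (intro allI impI)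
  fix A :: "nat \<Rightarrow> 's set"
  assume A: "range A \<subseteq> sets M" "disjoint_family A"
  let ?F = "indefinite_integral M \<phi>"
  define D where "D N = (\<Union>n. A n) - (\<Union>n<N. A n)" for N
  note [measurable] = borel_measurable_integrable[OF L2_imp_integrable_norm[OF M \<phi>]]
  have [measurable]: "A n \<in> sets M" for n
    using A by auto
  have [measurable]: "D N \<in> sets M" for N
    unfolding D_def by measurable
  have U: "(\<Union>n. A n) \<in> sets M"
    by measurable
  have D: "indicator (\<Union>n. A n) s *\<^sub>R \<phi> s - (\<Sum>n<N. indicator (A n) s *\<^sub>R \<phi> s)
      = indicator (D N) s *\<^sub>R \<phi> s" for N s
  proof -
    have "(\<Sum>n<N. indicator (A n) s :: real) = indicator (\<Union>n<N. A n) s"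
      using A(2) by (intro indicator_UN_disjoint[symmetric]) (auto simp: disjoint_family_on_def)
    then have "indicator (\<Union>n. A n) s - (\<Sum>n<N. indicator (A n) s :: real) = indicator (D N) s"
      by (auto simp: D_def indicator_def)
    then show ?thesis
      by (simp add: scaleR_sum_left[symmetric] scaleR_diff_left[symmetric])
  qed
  have le: "ennreal (norm (?F (\<Union>n. A n) - (\<Sum>n<N. ?F (A n))))
      \<le> (\<integral>\<^sup>+s. ennreal (indicator (D N) s * norm (\<phi> s)) \<partial>M)" for N
  proof -
    have "has_strong_bochner_integral M (\<lambda>s. indicator (D N) s *\<^sub>R \<phi> s)
        (?F (\<Union>n. A n) - (\<Sum>n<N. ?F (A n)))"
      unfolding D[symmetric]
      by (intro has_strong_bochner_integral_diff has_strong_bochner_integral_sum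
          has_strong_bochner_integral_indefinite_integral[OF M \<phi>] U) measurable
    from has_strong_bochner_integral_norm_bound[OF this] show ?thesis
      by simp
  qed
  have "(\<lambda>N. \<integral>\<^sup>+s. ennreal (indicator (D N) s * norm (\<phi> s)) \<partial>M) \<longlonglongrightarrow> (\<integral>\<^sup>+s. ennreal 0 \<partial>M)"
  proof (rule nn_integral_dominated_convergence[where w = "\<lambda>s. ennreal (norm (\<phi> s))"])
    show "AE s in M. ennreal (indicator (D N) s * norm (\<phi> s)) \<le> ennreal (norm (\<phi> s))" for N
      by (auto simp: indicator_def)
    show "(\<integral>\<^sup>+s. ennreal (norm (\<phi> s)) \<partial>M) < \<infinity>"
      using L2_imp_integrable_norm[OF M \<phi>] by (simp add: integrable_iff_bounded)
    show "AE s in M. (\<lambda>N. ennreal (indicator (D N) s * norm (\<phi> s))) \<longlonglongrightarrow> ennreal 0"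
    proof (rule AE_I2)
      fix s
      have "\<exists>K. \<forall>N\<ge>K. s \<notin> D N"
      proof (cases "s \<in> (\<Union>n. A n)")
        case True
        then obtain k where "s \<in> A k" by blast
        then have "\<forall>N\<ge>Suc k. s \<notin> D N"
          by (auto simp: D_def Suc_le_eq)
        then show ?thesis ..
      qed (auto simp: D_def)
      then have "\<forall>\<^sub>F N in sequentially. ennreal (indicator (D N) s * norm (\<phi> s)) = ennreal 0"
        unfolding eventually_sequentially by (auto simp: indicator_def)
      then show "(\<lambda>N. ennreal (indicator (D N) s * norm (\<phi> s))) \<longlonglongrightarrow> ennreal 0"
        by (rule tendsto_eventually)
    qed
  qed measurable
  then have "(\<lambda>N. \<integral>\<^sup>+s. ennreal (indicator (D N) s * norm (\<phi> s)) \<partial>M) \<longlonglongrightarrow> 0"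
    by simp
  then have "(\<lambda>N. ennreal (norm (?F (\<Union>n. A n) - (\<Sum>n<N. ?F (A n))))) \<longlonglongrightarrow> 0"
  proof (rule tendsto_sandwich[rotated 3])
    show "\<forall>\<^sub>F N in sequentially. 0 \<le> ennreal (norm (?F (\<Union>n. A n) - (\<Sum>n<N. ?F (A n))))"
      by simp
    show "\<forall>\<^sub>F N in sequentially. ennreal (norm (?F (\<Union>n. A n) - (\<Sum>n<N. ?F (A n))))
        \<le> (\<integral>\<^sup>+s. ennreal (indicator (D N) s * norm (\<phi> s)) \<partial>M)"
      using le by simp
  qed simp_all
  then have "(\<lambda>N. ennreal (norm (?F (\<Union>n. A n) - (\<Sum>n<N. ?F (A n))))) \<longlonglongrightarrow> ennreal 0"
    by (simp only: ennreal_0)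
  then have "(\<lambda>N. norm (?F (\<Union>n. A n) - (\<Sum>n<N. ?F (A n)))) \<longlonglongrightarrow> 0"
    by (rule tendsto_ennrealD) auto
  then have "(\<lambda>N. ?F (\<Union>n. A n) - (?F (\<Union>n. A n) - (\<Sum>n<N. ?F (A n)))) \<longlonglongrightarrow> ?F (\<Union>n. A n) - 0"
    by (intro tendsto_intros) (simp add: tendsto_norm_zero_iff)
  then show "(\<lambda>n. ?F (A n)) sums ?F (\<Union>n. A n)"
    by (simp add: sums_def)
qed

section \<open>Infinite-dimensional \<open>L\<^sup>2\<close> spaces\<close>

text \<open>The constant is the mean over \<open>E\<close>. If the points of \<open>E\<close> with
  \<open>f\<close> below the mean were not null, they would fill \<open>E\<close> up to a null set;
  the mean minus \<open>f\<close> would then be nonnegative almost everywhere on \<open>E\<close>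
  with integral \<open>0\<close>, hence zero there. The other side is symmetric. A null set
  \<open>E\<close> satisfies the hypothesis too, and then any constant serves.\<close>

lemma AE_constant_on_atom:
  fixes f :: "'s \<Rightarrow> real"
  assumes M: "finite_measure M" and f: "integrable M f" and E: "E \<in> sets M"
    and atom: "\<And>A. A \<in> sets M \<Longrightarrow> A \<subseteq> E \<Longrightarrow> measure M A = 0 \<or> measure M (E - A) = 0"
  shows "\<exists>c. AE s in M. s \<in> E \<longrightarrow> f s = c"
proof (cases "measure M E = 0")
  case True
  interpret finite_measure M by fact
  have "AE s in M. s \<notin> E"
    using True E by (intro AE_not_in) (auto simp: null_sets_def emeasure_eq_measure)
  then show ?thesis by (intro exI[of _ 0]) auto
next
  case False
  interpret finite_measure M by fact
  have [measurable]: "f \<in> borel_measurable M" "E \<in> sets M" using f E by auto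
  define c where "c = (LINT s|M. indicator E s * f s) / measure M E"
  have notin: "AE s in M. s \<notin> A" if "A \<in> sets M" "measure M A = 0" for A
    using that by (intro AE_not_in) (auto simp: null_sets_def emeasure_eq_measure)
  \<comment> \<open>\<open>\<sigma>\<close> selects the side: \<open>1\<close> for the points where
    \<open>f\<close> lies below \<open>c\<close>, \<open>-1\<close> for those above.\<close>
  have null: "AE s in M. \<not> (s \<in> E \<and> 0 < \<sigma> * (c - f s))" if \<sigma>: "\<sigma> = 1 \<or> \<sigma> = -1" for \<sigma> :: real
  proof -
    define A where "A = {s\<in>space M. s \<in> E \<and> 0 < \<sigma> * (c - f s)}"
    have A: "A \<in> sets M" unfolding A_def by measurable
    have "A \<subseteq> E" unfolding A_def by auto
    have "measure M A = 0"
    proof (rule ccontr)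
      assume ne: "measure M A \<noteq> 0"
      with atom[OF A \<open>A \<subseteq> E\<close>] have "measure M (E - A) = 0" by simp
      then have "AE s in M. s \<notin> E - A" using A by (intro notin) auto
      then have pos: "AE s in M. 0 \<le> indicator E s * (\<sigma> * (c - f s))"
        by eventually_elim (auto simp: A_def indicator_def)
      have iE: "integrable M (\<lambda>s. indicator E s * f s)" "integrable M (indicator E :: 's \<Rightarrow> real)"
        using integrable_mult_indicator[OF E f] integrable_real_indicator[OF E]
        by (simp_all add: emeasure_eq_measure)
      have eq: "indicator E s * (\<sigma> * (c - f s)) = \<sigma> * c * indicator E s - \<sigma> * (indicator E s * f s)" for s
        by (simp add: algebra_simps)
      have int: "integrable M (\<lambda>s. indicator E s * (\<sigma> * (c - f s)))"
        unfolding eq using iE by simp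
      have "(LINT s|M. indicator E s * (\<sigma> * (c - f s))) = \<sigma> * c * measure M E - \<sigma> * (LINT s|M. indicator E s * f s)"
        unfolding eq using iE E by simp
      also have "\<dots> = 0"
        using False by (simp add: c_def)
      finally have "AE s in M. indicator E s * (\<sigma> * (c - f s)) = 0"
        using integral_nonneg_eq_0_iff_AE[OF int pos] by simp
      then have "AE s in M. s \<notin> A"
        by eventually_elim (auto simp: A_def)
      then have "measure M A = 0"
        using AE_iff_null_sets[OF A] measure_eq_0_null_sets by blast
      with ne show False ..
    qed
    with A have "AE s in M. s \<notin> A" by (rule notin)
    with AE_space show ?thesis by eventually_elim (auto simp: A_def)
  qed
  have "AE s in M. s \<in> E \<longrightarrow> f s = c"
    using null[of 1, simplified] null[of "-1", simplified] by eventually_elim auto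
  then show ?thesis ..
qed

text \<open>
  Splitting repeatedly a set that is not a finite union of atoms and null sets leaves behind
  infinitely many disjoint sets of positive measure.
\<close>

lemma infinite_dimensional_L2_disjoint_family:
  assumes M: "finite_measure M" and inf: "infinite_dimensional_L2 M"
  shows "\<exists>A :: nat \<Rightarrow> 's set. (\<forall>n. A n \<in> sets (M :: 's measure) \<and> 0 < measure M (A n)) \<and> disjoint_family A"
proof -
  interpret finite_measure M by fact
  \<comment> \<open>Null sets satisfy this definition, so \<open>fin\<close> needs no separate null
    part, and a measurable set that is not an atom splits into two parts of positive
    measure.\<close>
  define atom where "atom E \<longleftrightarrow> E \<in> sets M \<and>
    (\<forall>A\<in>sets M. A \<subseteq> E \<longrightarrow> measure M A = 0 \<or> measure M (E - A) = 0)" for E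
  define fin where "fin E \<longleftrightarrow> (\<exists>\<A>. finite \<A> \<and> (\<forall>A\<in>\<A>. atom A) \<and> disjoint \<A> \<and> \<Union>\<A> = E)" for E
  \<comment> \<open>On a finite partition into atoms every element of \<open>L2\<close> is almost
    everywhere a combination of their indicators, which would form a finite spanning set.\<close>
  have not_fin: "\<not> fin (space M)"
  proof
    assume "fin (space M)"
    then obtain \<A> where \<A>: "finite \<A>" "\<And>A. A \<in> \<A> \<Longrightarrow> atom A" "disjoint \<A>" "\<Union>\<A> = space M"
      unfolding fin_def by blast
    define ind where "ind = (indicator :: 's set \<Rightarrow> 's \<Rightarrow> real)"
    \<comment> \<open>\<open>infinite_dimensional_L2\<close> indexes coefficients by the spanning
      functions; injectivity transfers to them the coefficients indexed by atoms.\<close>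
    have inj: "inj_on ind \<A>"
    proof (rule inj_onI)
      fix A B assume "ind A = ind B"
      then have "x \<in> A \<longleftrightarrow> x \<in> B" for x
        unfolding ind_def by (metis indicator_eq_1_iff)
      then show "A = B" by blast
    qed
    have "ind ` \<A> \<subseteq> L2 M"
    proof safe
      fix A assume "A \<in> \<A>"
      then have A: "A \<in> sets M" using \<A>(2) by (simp add: atom_def)
      then have "strongly_measurable M (ind A)"
        unfolding ind_def by (intro strongly_measurable_simple simple_function_indicator)
      moreover have "integrable M (ind A)"
        unfolding ind_def using integrable_real_indicator[OF A] by (simp add: emeasure_eq_measure)
      moreover have "(\<lambda>s. (norm (ind A s))\<^sup>2) = ind A"
        by (auto simp: ind_def indicator_def)
      ultimately show "ind A \<in> L2 M"
        unfolding L2_def by simp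
    qed
    moreover have "\<forall>f\<in>L2 M. \<exists>c. AE s in M. f s = (\<Sum>b\<in>ind ` \<A>. c b * b s)"
    proof
      fix f :: "'s \<Rightarrow> real" assume f: "f \<in> L2 M"
      have "f \<in> borel_measurable M" "integrable M (\<lambda>s. (f s)\<^sup>2)"
        using f borel_measurable_strongly_measurable by (auto simp: L2_def)
      then have "integrable M f"
        by (rule square_integrable_imp_integrable)
      then have "\<exists>c. AE s in M. s \<in> A \<longrightarrow> f s = c" if "A \<in> \<A>" for A
        using \<A>(2)[OF that] unfolding atom_def by (intro AE_constant_on_atom[OF M]) auto
      then obtain k where k: "\<And>A. A \<in> \<A> \<Longrightarrow> AE s in M. s \<in> A \<longrightarrow> f s = k A"
        using bchoice[of \<A> "\<lambda>A c. AE s in M. s \<in> A \<longrightarrow> f s = c"] by auto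
      have "AE s in M. \<forall>A\<in>\<A>. s \<in> A \<longrightarrow> f s = k A"
        using k by (intro AE_finite_allI[OF \<A>(1)])
      then have "AE s in M. f s = (\<Sum>b\<in>ind ` \<A>. k (inv_into \<A> ind b) * b s)"
        using AE_space
      proof eventually_elim
        fix s assume s: "\<forall>A\<in>\<A>. s \<in> A \<longrightarrow> f s = k A" "s \<in> space M"
        then obtain A where A: "A \<in> \<A>" "s \<in> A"
          using \<A>(4) by blast
        have "(\<Sum>b\<in>ind ` \<A>. k (inv_into \<A> ind b) * b s) = (\<Sum>B\<in>\<A>. k B * ind B s)"
          by (simp add: sum.reindex[OF inj] inv_into_f_f[OF inj])
        also have "\<dots> = (\<Sum>B\<in>\<A>. if B = A then k A else 0)"
        proof (rule sum.cong)
          fix B assume "B \<in> \<A>"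
          then have "s \<notin> B" if "B \<noteq> A"
            using \<A>(3) A that by (auto simp: pairwise_def disjnt_def)
          then show "k B * ind B s = (if B = A then k A else 0)"
            using A by (auto simp: ind_def)
        qed simp
        also have "\<dots> = f s"
          using A s \<A>(1) by simp
        finally show "f s = (\<Sum>b\<in>ind ` \<A>. k (inv_into \<A> ind b) * b s)" ..
      qed
      then show "\<exists>c. AE s in M. f s = (\<Sum>b\<in>ind ` \<A>. c b * b s)"
        by (rule exI[of _ "\<lambda>b. k (inv_into \<A> ind b)"])
    qed
    ultimately have "\<exists>B::('s \<Rightarrow> real) set. finite B \<and> B \<subseteq> L2 M \<and>
        (\<forall>f\<in>L2 M. \<exists>c. AE s in M. f s = (\<Sum>b\<in>B. c b * b s))"
      by (intro exI[of _ "ind ` \<A>"] conjI finite_imageI \<A>(1))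
    then show False
      using inf unfolding infinite_dimensional_L2_def by simp
  qed
  \<comment> \<open>A set that is not \<open>fin\<close> can lose a part of positive measure and
    still not be \<open>fin\<close>: of two positive parts that make it up, one is not
    \<open>fin\<close>, and the other is split off.\<close>
  have split: "\<exists>A. A \<in> sets M \<and> A \<subseteq> E \<and> 0 < measure M A \<and> \<not> fin (E - A)"
    if E: "E \<in> sets M" "\<not> fin E" for E
  proof -
    have "\<not> atom E"
    proof
      assume "atom E"
      then have "fin E"
        unfolding fin_def by (intro exI[of _ "{E}"]) simp
      with E show False by blast
    qed
    then obtain A where A: "A \<in> sets M" "A \<subseteq> E" "measure M A \<noteq> 0" "measure M (E - A) \<noteq> 0"
      using E unfolding atom_def by blast
    have "\<not> (fin A \<and> fin (E - A))"
    proof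
      assume "fin A \<and> fin (E - A)"
      then obtain \<A> \<B> where \<A>: "finite \<A>" "\<forall>A\<in>\<A>. atom A" "disjoint \<A>" "\<Union>\<A> = A"
        and \<B>: "finite \<B>" "\<forall>A\<in>\<B>. atom A" "disjoint \<B>" "\<Union>\<B> = E - A"
        unfolding fin_def by blast
      have "disjoint (\<A> \<union> \<B>)"
        using \<A>(3) \<B>(3) by (rule disjoint_union) (use \<A>(4) \<B>(4) in auto)
      moreover have "\<Union>(\<A> \<union> \<B>) = E"
        using \<A>(4) \<B>(4) A(2) by auto
      ultimately have "fin E"
        unfolding fin_def using \<A> \<B> by (intro exI[of _ "\<A> \<union> \<B>"]) auto
      with E show False by blast
    qed
    moreover have "E - (E - A) = A" using A by auto
    \<comment> \<open>The part to split off is \<open>E - A\<close> if that set is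
      \<open>fin\<close>, and \<open>A\<close> otherwise.\<close>
    ultimately show ?thesis
      using A E by (cases "fin (E - A)") (auto simp: zero_less_measure_iff intro: exI[of _ "E - A"] exI[of _ A])
  qed
  \<comment> \<open>The sets \<open>E n\<close> decrease without becoming \<open>fin\<close>; the
    wanted disjoint sets are their successive differences.\<close>
  have "\<exists>E. \<forall>n. (E n \<in> sets M \<and> \<not> fin (E n)) \<and> (E (Suc n) \<subseteq> E n \<and> 0 < measure M (E n - E (Suc n)))"
  proof (rule dependent_nat_choice)
    show "\<exists>E. E \<in> sets M \<and> \<not> fin E"
      using not_fin by blast
    fix E and n :: nat assume "E \<in> sets M \<and> \<not> fin E"
    then have E: "E \<in> sets M" "\<not> fin E" by auto
    from split[OF this] obtain A where "A \<in> sets M" "A \<subseteq> E" "0 < measure M A" "\<not> fin (E - A)"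
      by blast
    moreover from this have "E - (E - A) = A" by auto
    ultimately show "\<exists>E'. (E' \<in> sets M \<and> \<not> fin E') \<and> E' \<subseteq> E \<and> 0 < measure M (E - E')"
      using E by (intro exI[of _ "E - A"]) auto
  qed
  then obtain E where E: "\<And>n. E n \<in> sets M" "\<And>n. E (Suc n) \<subseteq> E n"
      "\<And>n. 0 < measure M (E n - E (Suc n))"
    by blast
  have "decseq E"
    using E(2) by (rule decseq_SucI)
  have "(E m - E (Suc m)) \<inter> (E n - E (Suc n)) = {}" if "m < n" for m n
    using decseqD[OF \<open>decseq E\<close>, of "Suc m" n] that by auto
  then have "disjoint_family (\<lambda>n. E n - E (Suc n))"
    unfolding disjoint_family_on_def by (metis inf_commute linorder_neqE_nat)
  with E show ?thesis
    by (intro exI[of _ "\<lambda>n. E n - E (Suc n)"]) auto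
qed

section \<open>Gaussian and Rademacher sums\<close>

lemma strongly_measurable_sum_scaleR:
  fixes v :: "'i \<Rightarrow> 'x::real_normed_vector"
  assumes "\<And>i. i \<in> I \<Longrightarrow> f i \<in> borel_measurable M"
  shows "strongly_measurable M (\<lambda>s. \<Sum>i\<in>I. f i s *\<^sub>R v i)"
  using assms
proof (induction I rule: infinite_finite_induct)
  case (insert i I)
  have "strongly_measurable M (\<lambda>s. f i s *\<^sub>R v i)"
    by (rule strongly_measurable_compose[OF strongly_measurable_borel])
       (use insert in \<open>auto intro: continuous_on_scaleR continuous_on_id\<close>)
  then show ?case
    using insert by (simp add: strongly_measurable_add)
qed (simp_all add: strongly_measurable_simple)

text \<open>The norm of a random sum is a real function even when the sum has values in a
  nonseparable space; with this declaration \<open>measurable\<close> handles the integrands of the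
  comparisons below.\<close>

lemma borel_measurable_norm_sum_scaleR [measurable (raw)]:
  fixes v :: "'i \<Rightarrow> 'x::real_normed_vector"
  assumes "\<And>i. i \<in> I \<Longrightarrow> f i \<in> borel_measurable M"
  shows "(\<lambda>s. norm (\<Sum>i\<in>I. f i s *\<^sub>R v i)) \<in> borel_measurable M"
  using borel_measurable_norm_strongly_measurable[OF strongly_measurable_sum_scaleR[OF assms]] .

text \<open>By independence the joint law is the product of the marginal laws, and a symmetric
  marginal law does not change under a factor \<open>-1\<close>. The signs are fixed numbers here;
  random signs are handled later by conditioning.\<close>

lemma (in prob_space) nn_integral_sign_invariant:
  fixes X :: "'i \<Rightarrow> 'a \<Rightarrow> real"
  assumes indep: "indep_vars (\<lambda>_. borel) X I" and "finite I"
    and sym: "\<And>i. i \<in> I \<Longrightarrow> distr M borel (\<lambda>w. - X i w) = distr M borel (X i)"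
    and \<epsilon>: "\<And>i. i \<in> I \<Longrightarrow> \<epsilon> i = 1 \<or> \<epsilon> i = -1"
    and h: "h \<in> borel_measurable (\<Pi>\<^sub>M i\<in>I. borel)"
  shows "(\<integral>\<^sup>+w. h (\<lambda>i\<in>I. \<epsilon> i * X i w) \<partial>M) = (\<integral>\<^sup>+w. h (\<lambda>i\<in>I. X i w) \<partial>M)"
\<comment> \<open>The product description of the joint law is used for nonempty \<open>I\<close>;
  for empty \<open>I\<close> both integrands coincide.\<close>
proof (cases "I = {}")
  case False
  have X: "X i \<in> borel_measurable M" if "i \<in> I" for i
    using indep that by (auto simp: indep_vars_def)
  have indep': "indep_vars (\<lambda>_. borel) (\<lambda>i w. \<epsilon> i * X i w) I"
    by (rule indep_vars_compose2[OF indep]) simp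
  have "distr M (\<Pi>\<^sub>M i\<in>I. borel) (\<lambda>w. \<lambda>i\<in>I. \<epsilon> i * X i w) = (\<Pi>\<^sub>M i\<in>I. distr M borel (\<lambda>w. \<epsilon> i * X i w))"
    using indep' X False by (intro indep_vars_iff_distr_eq_PiM'[THEN iffD1]) auto
  also have "\<dots> = (\<Pi>\<^sub>M i\<in>I. distr M borel (X i))"
    by (rule PiM_cong[OF refl]) (use \<epsilon> sym in fastforce)
  also have "\<dots> = distr M (\<Pi>\<^sub>M i\<in>I. borel) (\<lambda>w. \<lambda>i\<in>I. X i w)"
    using indep X False by (intro indep_vars_iff_distr_eq_PiM'[THEN iffD1, symmetric]) auto
  finally have eq: "distr M (\<Pi>\<^sub>M i\<in>I. borel) (\<lambda>w. \<lambda>i\<in>I. \<epsilon> i * X i w)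
      = distr M (\<Pi>\<^sub>M i\<in>I. borel) (\<lambda>w. \<lambda>i\<in>I. X i w)" .
  have "(\<integral>\<^sup>+w. h (\<lambda>i\<in>I. \<epsilon> i * X i w) \<partial>M)
      = (\<integral>\<^sup>+y. h y \<partial>distr M (\<Pi>\<^sub>M i\<in>I. borel) (\<lambda>w. \<lambda>i\<in>I. \<epsilon> i * X i w))"
    using h X by (subst nn_integral_distr) (auto intro!: measurable_restrict)
  also have "\<dots> = (\<integral>\<^sup>+w. h (\<lambda>i\<in>I. X i w) \<partial>M)"
    unfolding eq using h X by (subst nn_integral_distr) (auto intro!: measurable_restrict)
  finally show ?thesis .
qed (simp add: restrict_def)

lemma (in prob_space) nn_integral_norm_sum_sign_invariant:
  fixes X :: "nat \<Rightarrow> 'a \<Rightarrow> real" and v :: "nat \<Rightarrow> 'x::real_normed_vector"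
  assumes indep: "indep_vars (\<lambda>_. borel) X UNIV"
    and sym: "\<And>n. distr M borel (\<lambda>w. - X n w) = distr M borel (X n)"
    and \<epsilon>: "\<And>n. n < N \<Longrightarrow> \<epsilon> n = 1 \<or> \<epsilon> n = -1"
  shows "(\<integral>\<^sup>+w. ennreal ((norm (\<Sum>n<N. (\<epsilon> n * X n w) *\<^sub>R v n))\<^sup>2) \<partial>M)
    = (\<integral>\<^sup>+w. ennreal ((norm (\<Sum>n<N. X n w *\<^sub>R v n))\<^sup>2) \<partial>M)"
proof -
  define h where "h x = ennreal ((norm (\<Sum>n<N. x n *\<^sub>R v n))\<^sup>2)" for x
  have "h \<in> borel_measurable (\<Pi>\<^sub>M n\<in>{..<N}. borel)"
    unfolding h_def by measurable
  from nn_integral_sign_invariant[OF indep_vars_subset[OF indep] _ sym \<epsilon> this]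
  show ?thesis
    by (simp add: h_def)
qed

text \<open>The square of a finite sum is at most the number of terms times the sum of the squares.
  The expectations in \<open>gamma_variation\<close> and \<open>type2_constant\<close> are thereby
  genuine: the real integral of a nonintegrable function would be \<open>0\<close> by
  convention.\<close>

lemma integrable_norm_sum_scaleR_square:
  fixes v :: "'i \<Rightarrow> 'x::real_normed_vector" and f :: "'i \<Rightarrow> 's \<Rightarrow> real"
  assumes f: "\<And>i. i \<in> I \<Longrightarrow> f i \<in> borel_measurable M" "\<And>i. i \<in> I \<Longrightarrow> integrable M (\<lambda>s. (f i s)\<^sup>2)"
  shows "integrable M (\<lambda>s. (norm (\<Sum>i\<in>I. f i s *\<^sub>R v i))\<^sup>2)"
proof (rule Bochner_Integration.integrable_bound)
  show "integrable M (\<lambda>s. (\<Sum>i\<in>I. (f i s)\<^sup>2 * (norm (v i))\<^sup>2) * card I)"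
    using f(2) by (intro integrable_mult_left integrable_sum) auto
  show "AE s in M. norm ((norm (\<Sum>i\<in>I. f i s *\<^sub>R v i))\<^sup>2)
      \<le> norm ((\<Sum>i\<in>I. (f i s)\<^sup>2 * (norm (v i))\<^sup>2) * card I)"
  proof (rule AE_I2)
    fix s
    have "(norm (\<Sum>i\<in>I. f i s *\<^sub>R v i))\<^sup>2 \<le> (\<Sum>i\<in>I. \<bar>f i s\<bar> * norm (v i))\<^sup>2"
      by (intro power_mono) (auto intro: sum_norm_le)
    also have "\<dots> \<le> (\<Sum>i\<in>I. (\<bar>f i s\<bar> * norm (v i))\<^sup>2) * card I"
      by (rule sum_squared_le_sum_of_squares)
    finally show "norm ((norm (\<Sum>i\<in>I. f i s *\<^sub>R v i))\<^sup>2)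
        \<le> norm ((\<Sum>i\<in>I. (f i s)\<^sup>2 * (norm (v i))\<^sup>2) * card I)"
      by (simp add: power_mult_distrib sum_nonneg)
  qed
qed (use f(1) in measurable)

lemma nn_integral_norm_sum_scaleR_square:
  fixes v :: "'i \<Rightarrow> 'x::real_normed_vector" and f :: "'i \<Rightarrow> 's \<Rightarrow> real"
  assumes "\<And>i. i \<in> I \<Longrightarrow> f i \<in> borel_measurable M" "\<And>i. i \<in> I \<Longrightarrow> integrable M (\<lambda>s. (f i s)\<^sup>2)"
  shows "(\<integral>\<^sup>+s. ennreal ((norm (\<Sum>i\<in>I. f i s *\<^sub>R v i))\<^sup>2) \<partial>M)
    = ennreal (LINT s|M. (norm (\<Sum>i\<in>I. f i s *\<^sub>R v i))\<^sup>2)"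
  by (rule nn_integral_eq_integral[OF integrable_norm_sum_scaleR_square[OF assms]]) auto

section \<open>Laws and moments of Gaussian and Rademacher variables\<close>

lemma gaussian_sequence_borel_measurable:
  assumes "gaussian_sequence P g"
  shows "g n \<in> borel_measurable P"
proof -
  have "distributed P lborel (g n) (\<lambda>x. ennreal (std_normal_density x))"
    using assms unfolding gaussian_sequence_def by simp
  from distributed_measurable[OF this] show ?thesis by simp
qed

lemma gaussian_sequence_symmetric:
  assumes "gaussian_sequence P g"
  shows "distr P borel (\<lambda>w. - g n w) = distr P borel (g n)"
proof -
  have D: "distributed P lborel (g n) (normal_density 0 1)"
    using assms unfolding gaussian_sequence_def by simp
  have D': "distributed P lborel (\<lambda>w. - g n w) (normal_density 0 1)"
    using prob_space.normal_density_affine[OF _ D, of "-1" 0] assms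
    unfolding gaussian_sequence_def by simp
  have "distr P borel (\<lambda>w. - g n w) = distr P lborel (\<lambda>w. - g n w)"
    by (rule distr_cong) auto
  also have "\<dots> = distr P lborel (g n)"
    using distributed_distr_eq_density[OF D] distributed_distr_eq_density[OF D'] by simp
  also have "\<dots> = distr P borel (g n)"
    by (rule distr_cong) auto
  finally show ?thesis .
qed

lemma gaussian_sequence_second_moment:
  assumes "gaussian_sequence P g"
  shows "integrable P (\<lambda>w. (g n w)\<^sup>2)" "(LINT w|P. (g n w)\<^sup>2) = 1"
proof -
  have D: "distributed P lborel (g n) (\<lambda>x. ennreal (std_normal_density x))"
    using assms unfolding gaussian_sequence_def by simp
  show "integrable P (\<lambda>w. (g n w)\<^sup>2)"
    using distributed_integrable[OF D, of "\<lambda>x. x\<^sup>2"] integrable_std_normal_moment[of 2] by simp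
  show "(LINT w|P. (g n w)\<^sup>2) = 1"
    using distributed_integral[OF D, of "\<lambda>x. x\<^sup>2"] integral_std_normal_moment_even[of 1] by simp
qed

lemma gaussian_sequence_abs_moment:
  assumes "gaussian_sequence P g"
  shows "integrable P (\<lambda>w. \<bar>g n w\<bar>)" "(LINT w|P. \<bar>g n w\<bar>) = sqrt (2 / pi)"
proof -
  have D: "distributed P lborel (g n) (\<lambda>x. ennreal (std_normal_density x))"
    using assms unfolding gaussian_sequence_def by simp
  show "integrable P (\<lambda>w. \<bar>g n w\<bar>)"
    using distributed_integrable[OF D, of abs] integrable_std_normal_moment_abs[of 1] by simp
  show "(LINT w|P. \<bar>g n w\<bar>) = sqrt (2 / pi)"
    using distributed_integral[OF D, of abs] integral_std_normal_moment_abs_odd[of 0] by simp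
qed

text \<open>The two masses of \<open>1/2\<close> exhaust the probability, which determines the law
  of \<open>X\<close>. Other values remain possible on a null set, so later arguments about signs
  hold only almost everywhere.\<close>

lemma (in prob_space) measure_two_point:
  assumes X: "X \<in> borel_measurable M"
    and p: "prob {w\<in>space M. X w = 1} = 1/2" "prob {w\<in>space M. X w = - 1} = (1/2 :: real)"
    and A: "A \<in> sets borel"
  shows "prob {w\<in>space M. X w \<in> A} = (indicator A 1 + indicator A (- 1)) / (2 :: real)"
    and "AE w in M. X w = (1 :: real) \<or> X w = - 1"
proof -
  note [measurable] = X A
  have "prob ({w\<in>space M. X w = 1} \<union> {w\<in>space M. X w = - 1}) = 1"
    using p by (subst finite_measure_Union) auto
  then have "AE w in M. w \<in> {w\<in>space M. X w = 1} \<union> {w\<in>space M. X w = - 1}"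
    by (subst (asm) prob_eq_1) auto
  then show AE: "AE w in M. X w = 1 \<or> X w = - 1"
    by eventually_elim auto
  have "prob {w\<in>space M. X w \<in> A} = prob ({w\<in>space M. X w = 1 \<and> 1 \<in> A} \<union> {w\<in>space M. X w = - 1 \<and> - 1 \<in> A})"
    by (rule finite_measure_eq_AE) (use AE in \<open>auto elim!: eventually_mono\<close>)
  also have "\<dots> = prob {w\<in>space M. X w = 1 \<and> 1 \<in> A} + prob {w\<in>space M. X w = - 1 \<and> - 1 \<in> A}"
    by (rule finite_measure_Union) auto
  also have "\<dots> = (indicator A 1 + indicator A (- 1)) / 2"
    using p by (auto simp: indicator_def)
  finally show "prob {w\<in>space M. X w \<in> A} = (indicator A 1 + indicator A (- 1)) / 2" .
qed

lemma rademacher_sequence_borel_measurable: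
  assumes "rademacher_sequence R r"
  shows "r n \<in> borel_measurable R"
  using assms prob_space.indep_vars_def2[of R "\<lambda>_. borel" r UNIV]
  unfolding rademacher_sequence_def by simp

lemma rademacher_sequence_AE:
  assumes "rademacher_sequence R r"
  shows "AE w in R. \<forall>n. r n w = 1 \<or> r n w = - 1"
  unfolding AE_all_countable
proof
  fix n
  show "AE w in R. r n w = 1 \<or> r n w = - 1"
    by (rule prob_space.measure_two_point(2)[OF _ rademacher_sequence_borel_measurable[OF assms], where A = "{}"])
       (use assms in \<open>auto simp: rademacher_sequence_def\<close>)
qed

text \<open>\<open>measure_two_point\<close> applies to \<open>r n\<close> and to its negative, for
  which the two defining events are exchanged, and gives both the same law.\<close>

lemma rademacher_sequence_symmetric:
  assumes "rademacher_sequence R r"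
  shows "distr R borel (\<lambda>w. - r n w) = distr R borel (r n)"
proof (rule measure_eqI)
  interpret prob_space R using assms by (simp add: rademacher_sequence_def)
  have p: "prob {w\<in>space R. r n w = 1} = 1/2" "prob {w\<in>space R. r n w = - 1} = 1/2"
    using assms by (auto simp: rademacher_sequence_def)
  have eq: "{w\<in>space R. - r n w = 1} = {w\<in>space R. r n w = - 1}"
    "{w\<in>space R. - r n w = - 1} = {w\<in>space R. r n w = 1}"
    by (auto simp: minus_equation_iff)
  note r[measurable] = rademacher_sequence_borel_measurable[OF assms, of n]
  fix A assume "A \<in> sets (distr R borel (\<lambda>w. - r n w))"
  then have A: "A \<in> sets borel" by simp
  have "prob {w\<in>space R. - r n w \<in> A} = prob {w\<in>space R. r n w \<in> A}"
    using measure_two_point(1)[OF r p A] measure_two_point(1)[OF _ _ _ A, of "\<lambda>w. - r n w"] p r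
    unfolding eq by simp
  moreover have "(\<lambda>w. - r n w) -` A \<inter> space R = {w\<in>space R. - r n w \<in> A}"
    "r n -` A \<inter> space R = {w\<in>space R. r n w \<in> A}"
    by auto
  ultimately show "emeasure (distr R borel (\<lambda>w. - r n w)) A = emeasure (distr R borel (r n)) A"
    using A by (simp add: emeasure_distr emeasure_eq_measure)
qed simp

lemma rademacher_sequence_square_integrable:
  assumes "rademacher_sequence R r"
  shows "integrable R (\<lambda>w. (r n w)\<^sup>2)"
proof -
  interpret prob_space R using assms by (simp add: rademacher_sequence_def)
  note [measurable] = rademacher_sequence_borel_measurable[OF assms]
  have "AE w in R. norm ((r n w)\<^sup>2) \<le> 1"
    using rademacher_sequence_AE[OF assms] by eventually_elim (auto dest!: spec[of _ n])
  then show ?thesis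
    by (rule integrable_const_bound) measurable
qed

section \<open>Comparison of Gaussian and Rademacher sums\<close>

lemma nn_integral_randomized_gaussian_sum:
  fixes v :: "nat \<Rightarrow> 'x::real_normed_vector"
  assumes g: "gaussian_sequence P g" and r: "rademacher_sequence R r"
  shows "(\<integral>\<^sup>+w. \<integral>\<^sup>+w'. ennreal ((norm (\<Sum>n<N. (r n w' * g n w) *\<^sub>R v n))\<^sup>2) \<partial>R \<partial>P)
    = (\<integral>\<^sup>+w. ennreal ((norm (\<Sum>n<N. g n w *\<^sub>R v n))\<^sup>2) \<partial>P)"
proof -
  interpret P: prob_space P using g by (simp add: gaussian_sequence_def)
  interpret R: prob_space R using r by (simp add: rademacher_sequence_def)
  interpret PR: pair_sigma_finite P R ..
  note [measurable] = gaussian_sequence_borel_measurable[OF g] rademacher_sequence_borel_measurable[OF r]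
  \<comment> \<open>Tonelli: once the signs are integrated last, the inner integral sees fixed signs
    and almost everywhere does not depend on them.\<close>
  have "(\<integral>\<^sup>+w. \<integral>\<^sup>+w'. ennreal ((norm (\<Sum>n<N. (r n w' * g n w) *\<^sub>R v n))\<^sup>2) \<partial>R \<partial>P)
      = (\<integral>\<^sup>+w'. \<integral>\<^sup>+w. ennreal ((norm (\<Sum>n<N. (r n w' * g n w) *\<^sub>R v n))\<^sup>2) \<partial>P \<partial>R)"
    by (rule PR.Fubini'[symmetric]) (simp add: case_prod_beta', measurable)
  also have "\<dots> = (\<integral>\<^sup>+w'. (\<integral>\<^sup>+w. ennreal ((norm (\<Sum>n<N. g n w *\<^sub>R v n))\<^sup>2) \<partial>P) \<partial>R)"
  proof (rule nn_integral_cong_AE)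
    have indep: "P.indep_vars (\<lambda>_. borel) g UNIV"
      using g by (simp add: gaussian_sequence_def)
    show "AE w' in R. (\<integral>\<^sup>+w. ennreal ((norm (\<Sum>n<N. (r n w' * g n w) *\<^sub>R v n))\<^sup>2) \<partial>P)
        = (\<integral>\<^sup>+w. ennreal ((norm (\<Sum>n<N. g n w *\<^sub>R v n))\<^sup>2) \<partial>P)"
      using rademacher_sequence_AE[OF r]
    proof eventually_elim
      fix w' assume "\<forall>n. r n w' = 1 \<or> r n w' = - 1"
      then show "(\<integral>\<^sup>+w. ennreal ((norm (\<Sum>n<N. (r n w' * g n w) *\<^sub>R v n))\<^sup>2) \<partial>P)
          = (\<integral>\<^sup>+w. ennreal ((norm (\<Sum>n<N. g n w *\<^sub>R v n))\<^sup>2) \<partial>P)"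
        by (intro P.nn_integral_norm_sum_sign_invariant[OF indep gaussian_sequence_symmetric[OF g]]) auto
    qed
  qed
  also have "\<dots> = (\<integral>\<^sup>+w. ennreal ((norm (\<Sum>n<N. g n w *\<^sub>R v n))\<^sup>2) \<partial>P)"
    by (simp add: R.emeasure_space_1)
  finally show ?thesis .
qed

lemma gaussian_sum_le_type2_constant:
  fixes v :: "nat \<Rightarrow> 'x::real_normed_vector"
  assumes g: "gaussian_sequence P g" and r: "rademacher_sequence R r"
    and C: "type2_constant R r TYPE('x) C"
  shows "(LINT w|P. (norm (\<Sum>n<N. g n w *\<^sub>R v n))\<^sup>2) \<le> C\<^sup>2 * (\<Sum>n<N. (norm (v n))\<^sup>2)"
proof -
  note [measurable] = gaussian_sequence_borel_measurable[OF g] rademacher_sequence_borel_measurable[OF r]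
  \<comment> \<open>\<open>type2_constant\<close> speaks of \<open>1 \<le> N\<close>; for
    \<open>N = 0\<close> both sums are empty.\<close>
  have type2: "(LINT w|R. (norm (\<Sum>n<N. r n w *\<^sub>R u n))\<^sup>2) \<le> C\<^sup>2 * (\<Sum>n<N. (norm (u n))\<^sup>2)"
    for u :: "nat \<Rightarrow> 'x"
    using C by (cases "N \<ge> 1") (auto simp: type2_constant_def not_le)
  have "ennreal (LINT w|P. (norm (\<Sum>n<N. g n w *\<^sub>R v n))\<^sup>2)
      = (\<integral>\<^sup>+w. ennreal ((norm (\<Sum>n<N. g n w *\<^sub>R v n))\<^sup>2) \<partial>P)"
    by (rule nn_integral_norm_sum_scaleR_square[symmetric])
       (auto simp: gaussian_sequence_second_moment[OF g])
  also have "\<dots> = (\<integral>\<^sup>+w. \<integral>\<^sup>+w'. ennreal ((norm (\<Sum>n<N. r n w' *\<^sub>R g n w *\<^sub>R v n))\<^sup>2) \<partial>R \<partial>P)"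
    unfolding nn_integral_randomized_gaussian_sum[OF g r, symmetric] by simp
  also have "\<dots> = (\<integral>\<^sup>+w. ennreal (LINT w'|R. (norm (\<Sum>n<N. r n w' *\<^sub>R g n w *\<^sub>R v n))\<^sup>2) \<partial>P)"
    by (intro nn_integral_cong nn_integral_norm_sum_scaleR_square)
       (auto simp: rademacher_sequence_square_integrable[OF r])
  \<comment> \<open>With \<open>w\<close> fixed, type 2 is applied to the vectors
    \<open>g n w *\<^sub>R v n\<close>; the unit second moments of the \<open>g n\<close> then leave
    exactly the factor \<open>C\<^sup>2\<close>.\<close>
  also have "\<dots> \<le> (\<integral>\<^sup>+w. ennreal (C\<^sup>2 * (\<Sum>n<N. (g n w)\<^sup>2 * (norm (v n))\<^sup>2)) \<partial>P)"
    using type2[of "\<lambda>n. g n w *\<^sub>R v n" for w]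
    by (intro nn_integral_mono ennreal_leI) (simp add: power_mult_distrib)
  also have "\<dots> = ennreal (LINT w|P. C\<^sup>2 * (\<Sum>n<N. (g n w)\<^sup>2 * (norm (v n))\<^sup>2))"
    by (intro nn_integral_eq_integral integrable_mult_right integrable_sum integrable_mult_left)
       (auto simp: gaussian_sequence_second_moment[OF g] sum_nonneg)
  also have "(LINT w|P. C\<^sup>2 * (\<Sum>n<N. (g n w)\<^sup>2 * (norm (v n))\<^sup>2)) = C\<^sup>2 * (\<Sum>n<N. (norm (v n))\<^sup>2)"
    by (simp add: gaussian_sequence_second_moment[OF g])
  finally show ?thesis
    by (simp add: sum_nonneg)
qed

text \<open>
  By Jensen's inequality, replacing every \<open>\<bar>g n\<bar>\<close> by its mean decreases the second moment of the sum
  with coefficients \<open>r n * \<bar>g n\<bar>\<close>, and these coefficients are distributed as the \<open>g n\<close>.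
\<close>

lemma rademacher_sum_le_gaussian_sum:
  fixes v :: "nat \<Rightarrow> 'x::banach"
  assumes g: "gaussian_sequence P g" and r: "rademacher_sequence R r"
  shows "2 / pi * (LINT w|R. (norm (\<Sum>n<N. r n w *\<^sub>R v n))\<^sup>2)
    \<le> (LINT w|P. (norm (\<Sum>n<N. g n w *\<^sub>R v n))\<^sup>2)"
proof -
  interpret P: prob_space P using g by (simp add: gaussian_sequence_def)
  interpret R: prob_space R using r by (simp add: rademacher_sequence_def)
  interpret PR: pair_sigma_finite P R ..
  note [measurable] = gaussian_sequence_borel_measurable[OF g] rademacher_sequence_borel_measurable[OF r]
  \<comment> \<open>The mean of every \<open>\<bar>g n\<bar>\<close>, so that
    \<open>m\<^sup>2 = 2 / pi\<close>.\<close>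
  define m where "m = sqrt (2 / pi)"
  \<comment> \<open>For fixed \<open>t\<close> the vector on the left is the Bochner integral of the
    random sum on the right. The norm bound, followed by Cauchy-Schwarz against the constant
    \<open>1\<close> on a probability space, gives Jensen's inequality for the squared norm.\<close>
  have jensen: "ennreal ((norm (\<Sum>n<N. t n *\<^sub>R m *\<^sub>R v n))\<^sup>2)
      \<le> (\<integral>\<^sup>+w. ennreal ((norm (\<Sum>n<N. (t n * \<bar>g n w\<bar>) *\<^sub>R v n))\<^sup>2) \<partial>P)" for t
  proof -
    have "has_strong_bochner_integral P (\<lambda>w. \<Sum>n<N. \<bar>g n w\<bar> *\<^sub>R t n *\<^sub>R v n) (\<Sum>n<N. m *\<^sub>R t n *\<^sub>R v n)"
    proof (rule has_strong_bochner_integral_sum)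
      fix n
      show "has_strong_bochner_integral P (\<lambda>w. \<bar>g n w\<bar> *\<^sub>R t n *\<^sub>R v n) (m *\<^sub>R t n *\<^sub>R v n)"
        using has_strong_bochner_integral_integral[OF gaussian_sequence_abs_moment(1)[OF g, of n]]
        unfolding gaussian_sequence_abs_moment(2)[OF g] m_def[symmetric]
        by (rule has_strong_bochner_integral_linear[OF bounded_linear_scaleR_left])
    qed
    from has_strong_bochner_integral_norm_bound[OF this]
    have "ennreal (norm (\<Sum>n<N. t n *\<^sub>R m *\<^sub>R v n))
        \<le> (\<integral>\<^sup>+w. norm (\<Sum>n<N. (t n * \<bar>g n w\<bar>) *\<^sub>R v n) \<partial>P)"
      by (simp add: mult.commute)
    then have "(ennreal (norm (\<Sum>n<N. t n *\<^sub>R m *\<^sub>R v n)))\<^sup>2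
        \<le> (\<integral>\<^sup>+w. norm (\<Sum>n<N. (t n * \<bar>g n w\<bar>) *\<^sub>R v n) * 1 \<partial>P)\<^sup>2"
      by (intro power_mono) auto
    also have "\<dots> \<le> (\<integral>\<^sup>+w. (ennreal (norm (\<Sum>n<N. (t n * \<bar>g n w\<bar>) *\<^sub>R v n)))\<^sup>2 \<partial>P) * (\<integral>\<^sup>+w. 1\<^sup>2 \<partial>P)"
      using Cauchy_Schwarz_nn_integral[of "\<lambda>w. ennreal (norm (\<Sum>n<N. (t n * \<bar>g n w\<bar>) *\<^sub>R v n))" P "\<lambda>_. 1"]
      by simp
    finally show ?thesis
      by (simp add: P.emeasure_space_1 ennreal_power)
  qed
  have "ennreal (2 / pi * (LINT w|R. (norm (\<Sum>n<N. r n w *\<^sub>R v n))\<^sup>2))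
      = ennreal (LINT w|R. (norm (\<Sum>n<N. r n w *\<^sub>R m *\<^sub>R v n))\<^sup>2)"
  proof -
    have "(norm (\<Sum>n<N. r n w *\<^sub>R m *\<^sub>R v n))\<^sup>2 = 2 / pi * (norm (\<Sum>n<N. r n w *\<^sub>R v n))\<^sup>2" for w
    proof -
      have "(\<Sum>n<N. r n w *\<^sub>R m *\<^sub>R v n) = m *\<^sub>R (\<Sum>n<N. r n w *\<^sub>R v n)"
        by (simp add: scaleR_sum_right mult.commute)
      then show ?thesis
        by (simp add: power_mult_distrib m_def)
    qed
    then show ?thesis by simp
  qed
  also have "\<dots> = (\<integral>\<^sup>+w'. ennreal ((norm (\<Sum>n<N. r n w' *\<^sub>R m *\<^sub>R v n))\<^sup>2) \<partial>R)"
    by (rule nn_integral_norm_sum_scaleR_square[symmetric])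
       (auto simp: rademacher_sequence_square_integrable[OF r])
  also have "\<dots> \<le> (\<integral>\<^sup>+w'. \<integral>\<^sup>+w. ennreal ((norm (\<Sum>n<N. (r n w' * \<bar>g n w\<bar>) *\<^sub>R v n))\<^sup>2) \<partial>P \<partial>R)"
    by (intro nn_integral_mono jensen)
  also have "\<dots> = (\<integral>\<^sup>+w. \<integral>\<^sup>+w'. ennreal ((norm (\<Sum>n<N. (r n w' * \<bar>g n w\<bar>) *\<^sub>R v n))\<^sup>2) \<partial>R \<partial>P)"
    by (rule PR.Fubini') (simp add: case_prod_beta', measurable)
  \<comment> \<open>With \<open>w\<close> fixed, the signs of the \<open>g n w\<close> are constants
    \<open>\<epsilon> n\<close>, which the symmetric variables \<open>r n\<close> absorb.\<close>
  also have "\<dots> = (\<integral>\<^sup>+w. \<integral>\<^sup>+w'. ennreal ((norm (\<Sum>n<N. (r n w' * g n w) *\<^sub>R v n))\<^sup>2) \<partial>R \<partial>P)"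
  proof (rule nn_integral_cong)
    fix w
    have indep: "R.indep_vars (\<lambda>_. borel) r UNIV"
      using r by (simp add: rademacher_sequence_def)
    define \<epsilon> where "\<epsilon> n = (if 0 \<le> g n w then 1 else - 1 :: real)" for n
    have abs: "(r n w' * \<bar>g n w\<bar>) *\<^sub>R v n = (\<epsilon> n * r n w') *\<^sub>R g n w *\<^sub>R v n" for n w'
      by (simp add: \<epsilon>_def)
    have "(\<integral>\<^sup>+w'. ennreal ((norm (\<Sum>n<N. (\<epsilon> n * r n w') *\<^sub>R g n w *\<^sub>R v n))\<^sup>2) \<partial>R)
        = (\<integral>\<^sup>+w'. ennreal ((norm (\<Sum>n<N. r n w' *\<^sub>R g n w *\<^sub>R v n))\<^sup>2) \<partial>R)"
      by (rule R.nn_integral_norm_sum_sign_invariant[OF indep rademacher_sequence_symmetric[OF r]])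
         (simp add: \<epsilon>_def)
    then show "(\<integral>\<^sup>+w'. ennreal ((norm (\<Sum>n<N. (r n w' * \<bar>g n w\<bar>) *\<^sub>R v n))\<^sup>2) \<partial>R)
        = (\<integral>\<^sup>+w'. ennreal ((norm (\<Sum>n<N. (r n w' * g n w) *\<^sub>R v n))\<^sup>2) \<partial>R)"
      unfolding abs by simp
  qed
  also have "\<dots> = (\<integral>\<^sup>+w. ennreal ((norm (\<Sum>n<N. g n w *\<^sub>R v n))\<^sup>2) \<partial>P)"
    by (rule nn_integral_randomized_gaussian_sum[OF g r])
  also have "\<dots> = ennreal (LINT w|P. (norm (\<Sum>n<N. g n w *\<^sub>R v n))\<^sup>2)"
    by (rule nn_integral_norm_sum_scaleR_square)
       (auto simp: gaussian_sequence_second_moment[OF g])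
  finally show ?thesis
    by (simp add: integral_nonneg_AE)
qed

section \<open>The \<open>\<gamma>\<close>-variation of indefinite integrals\<close>

lemma norm_scaleR_inverse_sqrt_square:
  fixes v :: "'x::real_normed_vector"
  assumes "0 \<le> a"
  shows "(norm (v /\<^sub>R sqrt a))\<^sup>2 = (norm v)\<^sup>2 / a"
proof -
  have "norm (v /\<^sub>R sqrt a) = norm v / sqrt a"
    using assms by (simp add: divide_inverse_commute)
  then show ?thesis
    using assms by (simp add: power_divide)
qed

lemma gamma_variation_indefinite_integral_le:
  fixes \<phi> :: "'s \<Rightarrow> 'x::banach"
  assumes M: "finite_measure M" and g: "gaussian_sequence P g" and r: "rademacher_sequence R r"
    and C: "type2_constant R r TYPE('x) C" and \<phi>: "\<phi> \<in> L2 M"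
  shows "gamma_variation P g M (indefinite_integral M \<phi>) \<le> ennreal (C * L2_norm M \<phi>)"
  unfolding gamma_variation_def
proof (rule SUP_least, clarify, intro ennreal_leI)
  fix N :: nat and A :: "nat \<Rightarrow> 's set"
  assume A: "\<forall>n<N. A n \<in> sets M \<and> 0 < measure M (A n)" "disjoint_family_on A {..<N}"
  let ?F = "indefinite_integral M \<phi>"
  have i: "integrable M (\<lambda>s. (norm (\<phi> s))\<^sup>2)"
    using \<phi> by (simp add: L2_def)
  have iA: "integrable M (\<lambda>s. indicator (A n) s * (norm (\<phi> s))\<^sup>2)" if "n < N" for n
    using integrable_mult_indicator[OF _ i, of "A n"] A(1) that by simp
  have "(LINT w|P. (norm (\<Sum>n<N. g n w *\<^sub>R (?F (A n) /\<^sub>R sqrt (measure M (A n)))))\<^sup>2)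
      \<le> C\<^sup>2 * (\<Sum>n<N. (norm (?F (A n) /\<^sub>R sqrt (measure M (A n))))\<^sup>2)"
    by (rule gaussian_sum_le_type2_constant[OF g r C])
  also have "(\<Sum>n<N. (norm (?F (A n) /\<^sub>R sqrt (measure M (A n))))\<^sup>2)
      = (\<Sum>n<N. (norm (?F (A n)))\<^sup>2 / measure M (A n))"
    by (simp only: norm_scaleR_inverse_sqrt_square measure_nonneg)
  also have "\<dots> \<le> (\<Sum>n<N. LINT s|M. indicator (A n) s * (norm (\<phi> s))\<^sup>2)"
    using A by (intro sum_mono norm_indefinite_integral_square_le[OF M \<phi>]) auto
  also have "\<dots> = (LINT s|M. (\<Sum>n<N. indicator (A n) s * (norm (\<phi> s))\<^sup>2))"
    using iA by (intro Bochner_Integration.integral_sum[symmetric]) auto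
  also have "\<dots> \<le> (LINT s|M. (norm (\<phi> s))\<^sup>2)"
  proof (rule integral_mono)
    show "integrable M (\<lambda>s. \<Sum>n<N. indicator (A n) s * (norm (\<phi> s))\<^sup>2)"
      using iA by (intro Bochner_Integration.integrable_sum) auto
    fix s
    have "(\<Sum>n<N. indicator (A n) s :: real) = indicator (\<Union>n<N. A n) s"
      using A(2) by (intro indicator_UN_disjoint[symmetric]) auto
    then show "(\<Sum>n<N. indicator (A n) s * (norm (\<phi> s))\<^sup>2) \<le> (norm (\<phi> s))\<^sup>2"
      by (simp add: sum_distrib_right[symmetric] indicator_def)
  qed fact
  finally have "(LINT w|P. (norm (\<Sum>n<N. g n w *\<^sub>R (?F (A n) /\<^sub>R sqrt (measure M (A n)))))\<^sup>2)
      \<le> C\<^sup>2 * (LINT s|M. (norm (\<phi> s))\<^sup>2)"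
    by (simp add: mult_left_mono)
  then have "sqrt (LINT w|P. (norm (\<Sum>n<N. g n w *\<^sub>R (?F (A n) /\<^sub>R sqrt (measure M (A n)))))\<^sup>2)
      \<le> sqrt (C\<^sup>2 * (LINT s|M. (norm (\<phi> s))\<^sup>2))"
    by (rule real_sqrt_le_mono)
  \<comment> \<open>\<open>type2_constant\<close> includes \<open>0 \<le> C\<close>, which turns
    \<open>sqrt (C\<^sup>2)\<close> into \<open>C\<close>.\<close>
  also have "\<dots> = C * L2_norm M \<phi>"
    using C by (simp add: L2_norm_def real_sqrt_mult type2_constant_def)
  finally show "sqrt (LINT w|P. (norm (\<Sum>n<N. g n w *\<^sub>R (?F (A n) /\<^sub>R sqrt (measure M (A n)))))\<^sup>2)
      \<le> C * L2_norm M \<phi>" .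
qed

section \<open>A density of infinite \<gamma>-variation in spaces without type 2\<close>

lemma countably_valued_L2:
  fixes z :: "nat \<Rightarrow> 'x::real_normed_vector"
  assumes M: "finite_measure M" and A: "\<And>m. A m \<in> sets M" "disjoint_family A"
    and z: "summable (\<lambda>m. (norm (z m))\<^sup>2 * measure M (A m))"
  shows "\<exists>\<phi>\<in>L2 M. \<forall>m. \<forall>s\<in>A m. \<phi> s = z m"
proof -
  interpret finite_measure M by fact
  note [measurable] = A(1)
  \<comment> \<open>The index is unique by disjointness; off the union of the sets the value is
    \<open>0\<close>.\<close>
  define \<phi> where "\<phi> s = (if \<exists>m. s \<in> A m then z (THE m. s \<in> A m) else 0)" for s
  have uniq: "m = m'" if "s \<in> A m" "s \<in> A m'" for s m m'
    using A(2) that by (auto simp: disjoint_family_on_def)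
  have \<phi>: "\<phi> s = z m" if "s \<in> A m" for s m
  proof -
    have "(THE m. s \<in> A m) = m"
      using that uniq by (intro the_equality) auto
    then show ?thesis
      using that by (auto simp: \<phi>_def)
  qed
  have \<phi>_0: "\<phi> s = 0" if "\<And>m. s \<notin> A m" for s
    using that by (simp add: \<phi>_def)
  \<comment> \<open>Stated for every \<open>f\<close> with \<open>f 0 = 0\<close>, to be used twice:
    the identity gives strong measurability, and the squared norm gives the integral as a
    series.\<close>
  have sums: "(\<lambda>m. indicator (A m) s *\<^sub>R f (z m)) sums f (\<phi> s)"
    if "f 0 = 0" for s and f :: "'x \<Rightarrow> 'y::real_normed_vector"
  proof (cases "\<exists>m. s \<in> A m")
    case True
    then obtain m where m: "s \<in> A m" by blast
    have "(\<lambda>m'. indicator (A m') s *\<^sub>R f (z m')) = (\<lambda>m'. if m' = m then f (z m') else 0)"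
    proof
      fix m'
      show "indicator (A m') s *\<^sub>R f (z m') = (if m' = m then f (z m') else 0)"
      proof (cases "s \<in> A m'")
        case True
        then have "m' = m" using m by (rule uniq)
        with True show ?thesis by simp
      next
        case False
        with m have "m' \<noteq> m" by blast
        with False show ?thesis by simp
      qed
    qed
    then show ?thesis
      using sums_single[of m "\<lambda>m. f (z m)"] \<phi>[OF m] by simp
  next
    case False
    then show ?thesis
      using \<phi>_0[of s] that by (simp add: indicator_def)
  qed
  have sm: "strongly_measurable M \<phi>"
    unfolding strongly_measurable_def
  proof (intro exI conjI allI ballI)
    fix i
    show "simple_function M (\<lambda>s. \<Sum>m<i. indicator (A m) s *\<^sub>R z m)"
      using simple_function_compose1[OF simple_function_indicator[OF A(1)], where g = "\<lambda>x. x *\<^sub>R z _"]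
      by (rule simple_function_sum)
  next
    fix s
    show "(\<lambda>i. \<Sum>m<i. indicator (A m) s *\<^sub>R z m) \<longlonglongrightarrow> \<phi> s"
      using sums[of "\<lambda>x. x" s] by (simp add: sums_def)
  qed
  have "(\<integral>\<^sup>+s. ennreal ((norm (\<phi> s))\<^sup>2) \<partial>M)
      = (\<integral>\<^sup>+s. (\<Sum>m. ennreal (indicator (A m) s * (norm (z m))\<^sup>2)) \<partial>M)"
  proof (rule nn_integral_cong)
    fix s
    have "(\<lambda>m. indicator (A m) s * (norm (z m))\<^sup>2) sums (norm (\<phi> s))\<^sup>2"
      using sums[of "\<lambda>x. (norm x)\<^sup>2" s] by simp
    then show "ennreal ((norm (\<phi> s))\<^sup>2) = (\<Sum>m. ennreal (indicator (A m) s * (norm (z m))\<^sup>2))"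
      by (intro suminf_ennreal_eq[symmetric]) auto
  qed
  also have "\<dots> = (\<Sum>m. \<integral>\<^sup>+s. ennreal (indicator (A m) s * (norm (z m))\<^sup>2) \<partial>M)"
    by (intro nn_integral_suminf) measurable
  also have "\<dots> = (\<Sum>m. ennreal ((norm (z m))\<^sup>2 * measure M (A m)))"
  proof (rule suminf_cong)
    fix m
    have "(\<integral>\<^sup>+s. ennreal (indicator (A m) s * (norm (z m))\<^sup>2) \<partial>M)
        = (\<integral>\<^sup>+s. ennreal ((norm (z m))\<^sup>2) * indicator (A m) s \<partial>M)"
      by (intro nn_integral_cong) (auto simp: indicator_def)
    also have "\<dots> = ennreal ((norm (z m))\<^sup>2 * measure M (A m))"
      using A(1) by (simp add: nn_integral_cmult_indicator emeasure_eq_measure ennreal_mult)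
    finally show "(\<integral>\<^sup>+s. ennreal (indicator (A m) s * (norm (z m))\<^sup>2) \<partial>M)
        = ennreal ((norm (z m))\<^sup>2 * measure M (A m))" .
  qed
  also have "\<dots> = ennreal (\<Sum>m. (norm (z m))\<^sup>2 * measure M (A m))"
    by (rule suminf_ennreal2[OF _ z]) simp
  also have "\<dots> < \<infinity>"
    by simp
  finally have "integrable M (\<lambda>s. (norm (\<phi> s))\<^sup>2)"
    using borel_measurable_norm_strongly_measurable[OF sm]
    by (intro integrableI_bounded borel_measurable_power) simp_all
  with sm have "\<phi> \<in> L2 M"
    by (simp add: L2_def)
  with \<phi> show ?thesis
    by (intro bexI[of _ \<phi>]) simp_all
qed

text \<open>Both sides of the failed inequality for the constant \<open>4 ^ k\<close> are quadratic
  in the vectors, so the square sum can be normalised; the second moment is then at least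
  \<open>(4 ^ k)\<^sup>2 * (1 / 4) ^ k\<close>, which is \<open>4 ^ k\<close>.\<close>

lemma not_type2_blocks:
  assumes "\<not> type2 R r TYPE('x::real_normed_vector)"
  shows "\<exists>N (y :: nat \<Rightarrow> 'x). (\<Sum>n<N. (norm (y n))\<^sup>2) = (1 / 4) ^ k \<and>
    4 ^ k \<le> (LINT w|R. (norm (\<Sum>n<N. r n w *\<^sub>R y n))\<^sup>2)"
proof -
  have "\<not> type2_constant R r TYPE('x) (4 ^ k)"
    using assms unfolding type2_def by blast
  then obtain N and x :: "nat \<Rightarrow> 'x"
    where "\<not> (LINT w|R. (norm (\<Sum>n<N. r n w *\<^sub>R x n))\<^sup>2) \<le> (4 ^ k)\<^sup>2 * (\<Sum>n<N. (norm (x n))\<^sup>2)"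
    unfolding type2_constant_def by auto
  then have x: "(4 ^ k)\<^sup>2 * (\<Sum>n<N. (norm (x n))\<^sup>2) < (LINT w|R. (norm (\<Sum>n<N. r n w *\<^sub>R x n))\<^sup>2)"
    by simp
  define S where "S = (\<Sum>n<N. (norm (x n))\<^sup>2)"
  \<comment> \<open>Normalisation needs a nonzero family: if \<open>S\<close> vanished, so would all
    vectors and the second moment, against the strict inequality.\<close>
  have "S \<noteq> 0"
  proof
    assume "S = 0"
    then have "\<forall>n\<in>{..<N}. x n = 0"
      unfolding S_def by (subst (asm) sum_nonneg_eq_0_iff) auto
    with x \<open>S = 0\<close> show False
      unfolding S_def by simp
  qed
  then have S: "0 < S"
    unfolding S_def by (metis less_le sum_nonneg zero_le_power2)
  \<comment> \<open>Chosen so that \<open>c\<^sup>2 * S = (1 / 4) ^ k\<close>.\<close>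
  define c where "c = 1 / (2 ^ k * sqrt S)"
  have c: "c\<^sup>2 = (1 / 4) ^ k / S"
  proof -
    have "((2::real) ^ k)\<^sup>2 = 4 ^ k"
      by (simp add: power2_eq_square flip: power_mult_distrib)
    then show ?thesis
      using S by (simp add: c_def power_divide power_mult_distrib)
  qed
  have "(\<Sum>n<N. (norm (c *\<^sub>R x n))\<^sup>2) = c\<^sup>2 * S"
    by (simp add: S_def power_mult_distrib sum_distrib_left)
  also have "\<dots> = (1 / 4) ^ k"
    using S by (simp add: c)
  finally have 1: "(\<Sum>n<N. (norm (c *\<^sub>R x n))\<^sup>2) = (1 / 4) ^ k" .
  have "(4::real) ^ k = (1 / 4) ^ k * (4 ^ k)\<^sup>2"
    by (simp add: power2_eq_square power_divide)
  also have "\<dots> = c\<^sup>2 * ((4 ^ k)\<^sup>2 * S)"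
    unfolding c using S by simp
  also have "\<dots> \<le> c\<^sup>2 * (LINT w|R. (norm (\<Sum>n<N. r n w *\<^sub>R x n))\<^sup>2)"
    using x unfolding S_def by (intro mult_left_mono) auto
  also have "\<dots> = (LINT w|R. (norm (\<Sum>n<N. r n w *\<^sub>R c *\<^sub>R x n))\<^sup>2)"
  proof -
    have "(norm (\<Sum>n<N. r n w *\<^sub>R c *\<^sub>R x n))\<^sup>2 = c\<^sup>2 * (norm (\<Sum>n<N. r n w *\<^sub>R x n))\<^sup>2" for w
    proof -
      have "(\<Sum>n<N. r n w *\<^sub>R c *\<^sub>R x n) = c *\<^sub>R (\<Sum>n<N. r n w *\<^sub>R x n)"
        by (simp add: scaleR_sum_right mult.commute)
      then show ?thesis
        by (simp add: power_mult_distrib)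
    qed
    then show ?thesis by simp
  qed
  finally show ?thesis
    using 1 by (intro exI[of _ N] exI[of _ "\<lambda>n. c *\<^sub>R x n"]) simp
qed

text \<open>Blocks of varying length are laid out along one sequence by the pairing function. The
  code of row \<open>k\<close> and column \<open>n\<close> is at least \<open>k\<close>, so the
  first \<open>K\<close> codes lie in the first \<open>K\<close> rows, and a partial sum is bounded
  by the sum over these whole rows.\<close>

lemma summable_blocks:
  fixes f :: "nat \<Rightarrow> nat \<Rightarrow> real"
  assumes f: "\<And>k n. 0 \<le> f k n" and F: "summable (\<lambda>k. \<Sum>n<N k. f k n)"
  shows "summable (\<lambda>m. case prod_decode m of (k, n) \<Rightarrow> if n < N k then f k n else 0)"
proof (rule summableI_nonneg_bounded)
  define h where "h = (\<lambda>(k, n). if n < N k then f k n else 0)"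
  have h: "0 \<le> h p" for p
    using f by (simp add: h_def split: prod.split)
  show "0 \<le> (case prod_decode m of (k, n) \<Rightarrow> if n < N k then f k n else 0)" for m
    using h[of "prod_decode m"] by (simp add: h_def)
  fix K
  let ?S = "Sigma {..<K} (\<lambda>k. {..<N k})"
  have sub: "fst p < K" if "p \<in> prod_decode ` {..<K}" for p
  proof -
    have "prod_encode p < K" using that by auto
    with le_prod_encode_1[of "fst p" "snd p"] show ?thesis by simp
  qed
  have "(\<Sum>m<K. case prod_decode m of (k, n) \<Rightarrow> if n < N k then f k n else 0)
      = sum h (prod_decode ` {..<K})"
    by (subst sum.reindex) (auto simp: h_def inj_on_def prod_decode_eq)
  also have "\<dots> \<le> sum h (prod_decode ` {..<K} \<union> ?S)"
    using h by (intro sum_mono2) auto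
  also have "\<dots> = sum h ?S"
    using sub by (intro sum.mono_neutral_right) (force simp: h_def)+
  also have "\<dots> = (\<Sum>k<K. \<Sum>n<N k. f k n)"
    by (subst sum.Sigma) (auto simp: h_def intro!: sum.cong)
  also have "\<dots> \<le> (\<Sum>k. \<Sum>n<N k. f k n)"
    using f by (intro sum_le_suminf[OF F]) (auto intro: sum_nonneg)
  finally show "(\<Sum>m<K. case prod_decode m of (k, n) \<Rightarrow> if n < N k then f k n else 0)
      \<le> (\<Sum>k. \<Sum>n<N k. f k n)" .
qed

text \<open>
  Gliding hump: a space without type 2 has blocks of vectors with square sums \<open>4 ^ - k\<close> whose
  Gaussian sums are of order \<open>2 ^ k\<close>; spread over disjoint sets, they form one density whose
  indefinite integral has infinite \<open>\<gamma>\<close>-variation.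
\<close>

lemma bounded_gamma_variation_imp_type2:
  assumes M: "finite_measure M" and g: "gaussian_sequence P g" and r: "rademacher_sequence R r"
    and inf: "infinite_dimensional_L2 (M :: 's measure)"
    and bounded: "\<And>\<phi> :: 's \<Rightarrow> 'x::banach. \<phi> \<in> L2 M \<Longrightarrow>
      bounded_gamma_variation P g M (indefinite_integral M \<phi>)"
  shows "type2 R r TYPE('x)"
proof (rule ccontr)
  interpret finite_measure M by fact
  assume "\<not> type2 R r TYPE('x)"
  then have "\<forall>k. \<exists>N (y :: nat \<Rightarrow> 'x). (\<Sum>n<N. (norm (y n))\<^sup>2) = (1 / 4) ^ k \<and>
      4 ^ k \<le> (LINT w|R. (norm (\<Sum>n<N. r n w *\<^sub>R y n))\<^sup>2)"
    by (intro allI not_type2_blocks)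
  from choice[OF this] obtain N
    where "\<forall>k. \<exists>y :: nat \<Rightarrow> 'x. (\<Sum>n<N k. (norm (y n))\<^sup>2) = (1 / 4) ^ k \<and>
      4 ^ k \<le> (LINT w|R. (norm (\<Sum>n<N k. r n w *\<^sub>R y n))\<^sup>2)" ..
  from choice[OF this] obtain y :: "nat \<Rightarrow> nat \<Rightarrow> 'x"
    where "\<forall>k. (\<Sum>n<N k. (norm (y k n))\<^sup>2) = (1 / 4) ^ k \<and>
      4 ^ k \<le> (LINT w|R. (norm (\<Sum>n<N k. r n w *\<^sub>R y k n))\<^sup>2)" ..
  then have y: "\<And>k. (\<Sum>n<N k. (norm (y k n))\<^sup>2) = (1 / 4) ^ k"
    and large: "\<And>k. 4 ^ k \<le> (LINT w|R. (norm (\<Sum>n<N k. r n w *\<^sub>R y k n))\<^sup>2)"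
    by blast+
  obtain A :: "nat \<Rightarrow> 's set" where A: "\<And>m. A m \<in> sets M" "\<And>m. 0 < measure M (A m)" "disjoint_family A"
    using infinite_dimensional_L2_disjoint_family[OF M inf] by blast
  \<comment> \<open>Dividing by the square root makes the contribution of \<open>A m\<close> to the
    square integral equal to \<open>(norm (y k n))\<^sup>2\<close>, and makes the normalised value
    of the vector measure on \<open>A m\<close> equal to \<open>y k n\<close>. The sizes of the sets
    thus cancel. Positions beyond the end of a block get \<open>0\<close>.\<close>
  define z where "z m = (case prod_decode m of (k, n) \<Rightarrow>
      if n < N k then y k n /\<^sub>R sqrt (measure M (A m)) else 0)" for m
  have "(norm (z m))\<^sup>2 * measure M (A m)
      = (case prod_decode m of (k, n) \<Rightarrow> if n < N k then (norm (y k n))\<^sup>2 else 0)" for m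
    using A(2)[of m] by (simp add: z_def norm_scaleR_inverse_sqrt_square del: norm_scaleR split: prod.split)
  moreover have "summable (\<lambda>m. case prod_decode m of (k, n) \<Rightarrow> if n < N k then (norm (y k n))\<^sup>2 else 0)"
    by (rule summable_blocks) (simp_all add: y summable_geometric)
  ultimately have "summable (\<lambda>m. (norm (z m))\<^sup>2 * measure M (A m))"
    by simp
  from countably_valued_L2[OF M A(1,3) this]
  obtain \<phi> where \<phi>: "\<phi> \<in> L2 M" "\<And>m s. s \<in> A m \<Longrightarrow> \<phi> s = z m"
    by blast
  let ?F = "indefinite_integral M \<phi>"
  have F: "?F (A m) = measure M (A m) *\<^sub>R z m" for m
  proof -
    have "(\<lambda>s. indicator (A m) s *\<^sub>R \<phi> s) = (\<lambda>s. indicator (A m) s *\<^sub>R z m)"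
      using \<phi>(2) by (intro ext) (simp split: split_indicator)
    then show ?thesis
      unfolding indefinite_integral_def
      using strong_bochner_integral_eqI[OF has_strong_bochner_integral_indicator[OF A(1)[of m], of "z m"]]
      by (simp add: emeasure_eq_measure)
  qed
  define B where "B k n = A (prod_encode (k, n))" for k n
  have FB: "?F (B k n) /\<^sub>R sqrt (measure M (B k n)) = y k n" if "n < N k" for k n
    using A(2)[of "prod_encode (k, n)"] that
    by (simp add: B_def F z_def field_simps flip: power2_eq_square)
  \<comment> \<open>For each \<open>k\<close> the supremum is tested on the finitely many sets of
    block \<open>k\<close> alone, where the Gaussian sum is that of the vectors
    \<open>y k n\<close>.\<close>
  have lower: "ennreal (sqrt (2 / pi) * 2 ^ k) \<le> gamma_variation P g M ?F" for k
  proof -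
    have "sqrt (2 / pi) * 2 ^ k = sqrt (2 / pi * 4 ^ k)"
      unfolding real_sqrt_mult real_sqrt_power by simp
    also have "\<dots> \<le> sqrt (LINT w|P. (norm (\<Sum>n<N k. g n w *\<^sub>R y k n))\<^sup>2)"
      using large[of k] rademacher_sum_le_gaussian_sum[OF g r, where N = "N k" and v = "y k"]
      by (intro real_sqrt_le_mono order_trans[OF mult_left_mono[OF large]]) auto
    also have "\<dots> = sqrt (LINT w|P. (norm (\<Sum>n<N k. g n w *\<^sub>R (?F (B k n) /\<^sub>R sqrt (measure M (B k n)))))\<^sup>2)"
      using FB by (simp del: scaleR_scaleR)
    finally have "ennreal (sqrt (2 / pi) * 2 ^ k)
        \<le> ennreal (sqrt (LINT w|P. (norm (\<Sum>n<N k. g n w *\<^sub>R (?F (B k n) /\<^sub>R sqrt (measure M (B k n)))))\<^sup>2))"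
      by (rule ennreal_leI)
    also have "\<dots> \<le> gamma_variation P g M ?F"
    proof -
      have "disjoint_family_on (B k) {..<N k}"
        using A(3) unfolding disjoint_family_on_def B_def by (metis UNIV_I prod_encode_eq prod.inject)
      then show ?thesis
        unfolding gamma_variation_def
        using A(1,2) by (intro SUP_upper2[of "(N k, B k)"]) (auto simp: B_def)
    qed
    finally show ?thesis .
  qed
  have "gamma_variation P g M ?F < top"
    using bounded[OF \<phi>(1)] unfolding bounded_gamma_variation_def by simp
  then obtain c where c: "0 \<le> c" "gamma_variation P g M ?F = ennreal c"
    by (cases "gamma_variation P g M ?F") auto
  obtain k where "c / sqrt (2 / pi) < 2 ^ k"
    using real_arch_pow[of 2 "c / sqrt (2 / pi)"] by auto
  then have "c < sqrt (2 / pi) * 2 ^ k"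
    by (simp add: field_simps)
  with lower[of k] c show False
    by (simp add: ennreal_le_iff)
qed

text \<open>The first clause certifies that \<open>indefinite_integral\<close> is an actual Bochner
  integral rather than a default value. The estimate is stated for every admissible
  \<open>C\<close>; for \<open>C = 1\<close>, when admissible, it is the bound by the
  \<open>L2\<close> norm itself.\<close>

theorem corollary2p5:
  fixes M :: "'s measure"
    and P :: "'w measure" and g :: "nat \<Rightarrow> 'w \<Rightarrow> real"
    and R :: "'v measure" and r :: "nat \<Rightarrow> 'v \<Rightarrow> real"
  assumes "prob_space M"
    and "gaussian_sequence P g"
    and "rademacher_sequence R r"
  shows "(type2 R r TYPE('x::banach) \<longrightarrow>
            (\<forall>\<phi> \<in> (L2 M :: ('s \<Rightarrow> 'x) set).
               (\<forall>A\<in>sets M. has_strong_bochner_integral M (\<lambda>s. indicator A s *\<^sub>R \<phi> s)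
                               (indefinite_integral M \<phi> A)) \<and>
               vector_measure M (indefinite_integral M \<phi>) \<and>
               bounded_gamma_variation P g M (indefinite_integral M \<phi>) \<and>
               (\<forall>C. type2_constant R r TYPE('x) C \<longrightarrow>
                  gamma_variation P g M (indefinite_integral M \<phi>) \<le> ennreal (C * L2_norm M \<phi>))))
       \<and> (infinite_dimensional_L2 M \<longrightarrow>
            (type2 R r TYPE('x) \<longleftrightarrow>
              (\<forall>\<phi> \<in> (L2 M :: ('s \<Rightarrow> 'x) set).
                 vector_measure M (indefinite_integral M \<phi>) \<and>
                 bounded_gamma_variation P g M (indefinite_integral M \<phi>))))"
proof -
  have M: "finite_measure M"
    using assms(1) by (rule prob_space.finite_measure)
  note g = assms(2) and r = assms(3)
  have variation: "bounded_gamma_variation P g M (indefinite_integral M \<phi>)"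
    if type2: "type2 R r TYPE('x)" and \<phi>: "\<phi> \<in> L2 M" for \<phi> :: "'s \<Rightarrow> 'x"
  proof -
    obtain C where "type2_constant R r TYPE('x) C"
      using type2 unfolding type2_def ..
    from gamma_variation_indefinite_integral_le[OF M g r this \<phi>]
    have "gamma_variation P g M (indefinite_integral M \<phi>) < top"
      by (rule le_less_trans[OF _ ennreal_less_top])
    then show ?thesis
      by (simp add: bounded_gamma_variation_def)
  qed
  show ?thesis
  proof (intro conjI impI ballI allI iffI)
    fix \<phi> :: "'s \<Rightarrow> 'x" and A assume "\<phi> \<in> L2 M" "A \<in> sets M"
    then show "has_strong_bochner_integral M (\<lambda>s. indicator A s *\<^sub>R \<phi> s) (indefinite_integral M \<phi> A)"
      by (rule has_strong_bochner_integral_indefinite_integral[OF M])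
  next
    fix \<phi> :: "'s \<Rightarrow> 'x" and C assume "\<phi> \<in> L2 M" "type2_constant R r TYPE('x) C"
    then show "gamma_variation P g M (indefinite_integral M \<phi>) \<le> ennreal (C * L2_norm M \<phi>)"
      by (rule gamma_variation_indefinite_integral_le[OF M g r, rotated])
  next
    assume inf: "infinite_dimensional_L2 M" and
      "\<forall>\<phi> \<in> (L2 M :: ('s \<Rightarrow> 'x) set). vector_measure M (indefinite_integral M \<phi>) \<and>
        bounded_gamma_variation P g M (indefinite_integral M \<phi>)"
    then have "bounded_gamma_variation P g M (indefinite_integral M \<phi>)"
      if "\<phi> \<in> L2 M" for \<phi> :: "'s \<Rightarrow> 'x"
      using that by simp
    then show "type2 R r TYPE('x)"
      by (rule bounded_gamma_variation_imp_type2[OF M g r inf])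
  qed (assumption | rule vector_measure_indefinite_integral[OF M] variation)+
qed

end
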